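(* Consider a ring network whose agents know that $n\sim\sigma$, where $\sigma$ is the geometric prior on the integers of an interval $[\alpha,\beta]$. Then for every $k\ge 2$ the protocol "Knowledge Sharing in a Ring" (described in the context) is a distributed equilibrium for $k$-Knowledge Sharing if and only if $\beta\le 2\alpha-1$; likewise, it is a distributed equilibrium for Knowledge Sharing (i.e., for every $k$) if and only if $\beta\le 2\alpha-1$.
   Context: **Network and agents.** The network is a bidirectional ring with $n$ nodes ($n$ always denotes the actual number of nodes), with a global orientation. Each node is an agent with unlimited computational power. Agents communicate over edges in synchronous rounds and all start at round $0$. Initially each agent knows its own id and private input (including its preference), but not those of other agents. Private information comes from a finite set, and each agent's prior over the private information of the others is uniform. The agents do not know $n$ but know its prior $\sigma$. *Geometric prior on $[\alpha,\beta]$*: $\Pr[n=t]=2^{\alpha-t-1}+c$ for integers $\alpha\le t\le\beta$, where $c=\frac{2^{\alpha-\beta-1}}{\beta-\alpha+1}$. **Outputs and utilities.** Agent $a$ outputs $o_a$ ($\bot$ means it aborts). Output vectors are $O=(o_1,\dots,o_n)\in\Theta=\Theta_L\sqcup\Theta_E$, where $\Theta_L$ is the set of legal and $\Theta_E$ the set of erroneous output vectors. Each agent $a$ has a single preferred output value $p_a$ and utility $u_a(O)=1$ if $o_a=p_a$ and $O\in\Theta_L$, and $u_a(O)=0$ otherwise. An agent that detects that another agent deviated outputs $\bot$, which makes the output erroneous. **Equilibrium.** For a step $s$ (the entire operation of an agent in one round) of agent $a$ at round $r$ of an execution, $\mathbb{E}_{s,r}[u_a]=\sum_{O\in\Theta}x_O(s,r)u_a(O)$,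 where $x_O(s,r)$ is the probability, estimated by $a$ at round $r$, that $O$ is output if $a$ takes step $s$ and all other agents follow the algorithm. An algorithm $\Lambda$ whose next step at round $r$ is $s(r)$ is a (distributed) equilibrium if for every agent $a$, every round $r$ of every possible execution in which all steps up to round $r$ were according to $\Lambda$, and every deviating step $\bar s$: $\mathbb{E}_{s(r),r}[u_a]\ge \mathbb{E}_{\bar s,r}[u_a]$. Only a single agent deviates (no coalitions). **Duplication (Sybil attack).** A deviating agent may pretend to be $d$ agents, by simulating $d$ imaginary agents with fake ids and distributing its edges among them. The other agents then execute the algorithm as if on the enlarged ring, of size $n'=n+d-1$. Fake id collisions are disregarded. The cheater still produces a single output, and legality is judged on the output vector of the $n$ real agents. The number $d$ is decided at round $0$, before Wake-Up is completed. If $n'=d+n-1>\beta$, the duplication is detected and the output is erroneous. **$k$-Knowledge Sharing and Knowledge Sharing.** Each agent $a$ has a private input $i_a$; all agents have the same function $q$ with $|\mathrm{range}(q)|=k$, where $k$ and the output space are known to all agents. An output vector is legal iff all agents output the same value $\neq\bot$. The output is correct if every agent outputs $q(I)$, with $I$ the inputs of all agents. The function $q$ satisfies the Full Knowledge property: for any number $m$ of inputs, any $1\le j\le m$ and any fixed $(x_1,\dots,x_{j-1},x_{j+1},\dots,x_m)$, the number $|\{x_j : q(x_1,\dots,x_m)=y\}|$ is the same for every $y$ in the range of $q$ (inputs being uniform). Each agent $a$ prefers a certain output value $p_a$. A protocol for Knowledge Sharing solves $k$-Knowledge Sharing for every possible $k$, and it is an equilibrium if for any possible $k$ no agent has an incentive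 to cheat. **Secret-Transmit$(i_a,r,b)$.** Agent $a$ selects a random number $R_a$ and sets $X_a=R_a\oplus i_a$. It sends $R_a$ clockwise and $X_a$ counter-clockwise, each being forwarded until it reaches the agent just before $b$. At round $r-1$ the two neighbors of $b$ simultaneously send these two values to $b$, so $b$ learns $i_a$ at round $r$. **Protocol "Knowledge Sharing in a Ring".** (1) All agents execute Wake-Up, a preliminary phase after which every agent knows the ids of all agents and the size $n'$ of the ring (possibly including duplicated agents). (2) For each agent $a$ let $b^1_a$ be the clockwise neighbor of $a$ and $b^2_a$ the agent at distance $\lfloor n'/2\rfloor$ counter-clockwise from $a$. (3) Each agent $a$ simultaneously performs Secret-Transmit$(i_a,n',b^1_a)$ and Secret-Transmit$(i_a,n',b^2_a)$. (4) At round $n'+1$ each agent sends its input around the ring. (5) At round $2n'$ each agent outputs $q(I)$. *)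

theory Defs
  imports "HOL-Probability.Probability"
begin

text \<open>
  Agents are named by their position: Wake-Up lets all agents name one another consistently, and
  this is recorded as a common clockwise numbering \<open>0, \<dots>, N - 1\<close> of the (possibly enlarged) ring.
  Rounds are counted from the end of Wake-Up. In round \<open>t\<close> an agent first receives what its two
  neighbours sent in round \<open>t - 1\<close> and then sends one message over each of its two edges.
\<close>

unbundle bit_operations_syntax

section \<open>Prior on the ring size\<close>

definition geometric_prior :: "nat \<Rightarrow> nat \<Rightarrow> nat pmf" where
  "geometric_prior \<alpha> \<beta> = embed_pmf (\<lambda>t. if \<alpha> \<le> t \<and> t \<le> \<beta>
     then 2 powi (int \<alpha> - int t - 1) + 2 powi (int \<alpha> - int \<beta> - 1) / (real \<beta> - real \<alpha> + 1)
     else 0)"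

lemma pmf_geometric_prior:
  assumes "\<alpha> \<le> \<beta>"
  shows "pmf (geometric_prior \<alpha> \<beta>) t = (if \<alpha> \<le> t \<and> t \<le> \<beta>
     then 2 powi (int \<alpha> - int t - 1) + 2 powi (int \<alpha> - int \<beta> - 1) / (real \<beta> - real \<alpha> + 1)
     else 0)"
proof -
  define c where "c = 2 powi (int \<alpha> - int \<beta> - 1) / (real \<beta> - real \<alpha> + 1)"
  define g where "g t = (if \<alpha> \<le> t \<and> t \<le> \<beta> then 2 powi (int \<alpha> - int t - 1) + c else 0)" for t
  have c: "c \<ge> 0"
    using assms by (simp add: c_def)
  have nonneg: "g t \<ge> 0" for t
    using c by (simp add: g_def)
  have geo: "(\<Sum>t=\<alpha>..\<alpha>+m. 2 powi (int \<alpha> - int t - 1)) = 1 - (2::real) powi (- int m - 1)"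
    for m and \<alpha> :: nat
  proof (induction m)
    case (Suc m)
    have e: "- int m - 1 = 1 + (- int (Suc m) - 1)"
      by simp
    have "(2::real) powi (- int m - 1) = 2 * 2 powi (- int (Suc m) - 1)"
      unfolding e by (subst power_int_add) simp_all
    then show ?case
      using Suc by simp
  qed (simp add: power_int_minus)
  have "(\<Sum>t=\<alpha>..\<beta>. g t) = (\<Sum>t=\<alpha>..\<beta>. 2 powi (int \<alpha> - int t - 1)) + real (\<beta> + 1 - \<alpha>) * c"
    by (simp add: g_def sum.distrib)
  also have "real (\<beta> + 1 - \<alpha>) * c = 2 powi (int \<alpha> - int \<beta> - 1)"
    using assms by (simp add: c_def of_nat_diff add_ac field_simps)
  also have "(\<Sum>t=\<alpha>..\<beta>. 2 powi (int \<alpha> - int t - 1)) = 1 - (2::real) powi (int \<alpha> - int \<beta> - 1)"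
    using geo[of \<alpha> "\<beta> - \<alpha>"] assms by (simp add: of_nat_diff)
  finally have one: "(\<Sum>t=\<alpha>..\<beta>. g t) = 1"
    by simp
  have "(\<integral>\<^sup>+t. ennreal (g t) \<partial>count_space UNIV) = (\<integral>\<^sup>+t. ennreal (g t) \<partial>count_space {\<alpha>..\<beta>})"
    by (rule nn_integral_count_space_eq) (auto simp: g_def)
  also have "\<dots> = ennreal (\<Sum>t=\<alpha>..\<beta>. g t)"
    by (simp add: nn_integral_count_space_finite sum_ennreal nonneg)
  finally have "pmf (embed_pmf g) t = g t"
    using one nonneg by (intro pmf_embed_pmf) auto
  then show ?thesis
    by (simp only: geometric_prior_def g_def[abs_def] c_def)
qed

section \<open>Rings and messages\<close>

datatype dir = CW | CCW

primrec opp :: "dir \<Rightarrow> dir" where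
  "opp CW = CCW"
| "opp CCW = CW"

definition neighbour :: "nat \<Rightarrow> dir \<Rightarrow> nat \<Rightarrow> nat" where
  "neighbour N \<delta> p = (case \<delta> of CW \<Rightarrow> (p + 1) mod N | CCW \<Rightarrow> (p + N - 1) mod N)"

text \<open>Number of hops from \<open>a\<close> to \<open>b\<close> when travelling in direction \<open>\<delta>\<close> (for \<open>a, b < N\<close>).\<close>

definition hops :: "nat \<Rightarrow> dir \<Rightarrow> nat \<Rightarrow> nat \<Rightarrow> nat" where
  "hops N \<delta> a b = (case \<delta> of CW \<Rightarrow> (b + N - a) mod N | CCW \<Rightarrow> (a + N - b) mod N)"

datatype receiver = B1 | B2

primrec receiver_pos :: "nat \<Rightarrow> receiver \<Rightarrow> nat \<Rightarrow> nat" where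
  "receiver_pos N B1 a = (a + 1) mod N"
| "receiver_pos N B2 a = (a + N - N div 2) mod N"

text \<open>
  \<open>Share k a\<close> labels the two values of the Secret-Transmit from \<open>a\<close> to its receiver \<open>k\<close>: the value
  \<open>R\<^sub>a\<close> if it travels clockwise and \<open>X\<^sub>a\<close> if it travels counter-clockwise. \<open>Input a\<close> labels the
  input of \<open>a\<close> sent around the ring in the clear. A message carries any number of labelled values.
\<close>

datatype tag = Share receiver (origin: nat) | Input (origin: nat)

type_synonym msg = "tag \<rightharpoonup> nat"

text \<open>Entry \<open>h ! s\<close> of a history holds what was received in round \<open>s\<close>, by direction of travel; at
  round \<open>t\<close> the history has length \<open>t + 1\<close>.\<close>

type_synonym history = "(dir \<Rightarrow> msg) list"

section \<open>Agents, strategies and executions\<close>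

text \<open>What an agent knows when Wake-Up ends, together with its random numbers \<open>R\<^sub>a\<close>, one for each
  of its two Secret-Transmits.\<close>

record local_info =
  ring_size :: nat
  pos :: nat
  input :: nat
  coins :: "receiver \<Rightarrow> nat"

text \<open>An agent using strategy \<open>\<sigma>\<close> pretends to be \<open>dup \<sigma>\<close> agents; honest agents have \<open>dup \<sigma> = 1\<close>. It
  has only two edges to the other agents, so a duplicating agent also sends only two messages per
  round: one clockwise out of its last simulated agent, one counter-clockwise out of its first.\<close>

record strategy =
  dup :: nat
  send :: "local_info \<Rightarrow> history \<Rightarrow> dir \<Rightarrow> msg"
  result :: "local_info \<Rightarrow> history \<Rightarrow> nat option"

text \<open>The focal agent is the one whose incentives are examined; all others follow the algorithm.\<close>

record world =
  agents :: nat
  focal :: nat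
  inputs :: "nat list"
  pads :: "(receiver \<Rightarrow> nat) list"

text \<open>If the focal agent \<open>f\<close> pretends to be \<open>d\<close> agents, these occupy the positions \<open>f, \<dots>, f + d - 1\<close>
  of the enlarged ring.\<close>

definition info :: "nat \<Rightarrow> world \<Rightarrow> nat \<Rightarrow> local_info" where
  "info d \<omega> b = \<lparr>ring_size = agents \<omega> + d - 1,
                 pos = (if b \<le> focal \<omega> then b else b + d - 1),
                 input = inputs \<omega> ! b,
                 coins = pads \<omega> ! b\<rparr>"

definition strategy_of :: "strategy \<Rightarrow> strategy \<Rightarrow> world \<Rightarrow> nat \<Rightarrow> strategy" where
  "strategy_of \<Lambda> \<sigma> \<omega> b = (if b = focal \<omega> then \<sigma> else \<Lambda>)"

text \<open>History of the real agent \<open>b\<close> up to round \<open>t\<close> if the focal agent plays \<open>\<sigma>\<close> and all others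
  follow \<open>\<Lambda>\<close>.\<close>

primrec hist :: "strategy \<Rightarrow> strategy \<Rightarrow> world \<Rightarrow> nat \<Rightarrow> nat \<Rightarrow> history" where
  "hist \<Lambda> \<sigma> \<omega> 0 b = [\<lambda>\<delta>. Map.empty]"
| "hist \<Lambda> \<sigma> \<omega> (Suc t) b = hist \<Lambda> \<sigma> \<omega> t b @
     [\<lambda>\<delta>. let c = neighbour (agents \<omega>) (opp \<delta>) b
          in send (strategy_of \<Lambda> \<sigma> \<omega> c) (info (dup \<sigma>) \<omega> c) (hist \<Lambda> \<sigma> \<omega> t c) \<delta>]"

text \<open>The output vector of the real agents, produced at round \<open>2n'\<close>; \<open>None\<close> stands for \<open>\<bottom>\<close>.\<close>

definition outputs :: "strategy \<Rightarrow> strategy \<Rightarrow> world \<Rightarrow> nat option list" where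
  "outputs \<Lambda> \<sigma> \<omega> = map (\<lambda>b. result (strategy_of \<Lambda> \<sigma> \<omega> b) (info (dup \<sigma>) \<omega> b)
     (hist \<Lambda> \<sigma> \<omega> (2 * (agents \<omega> + dup \<sigma> - 1)) b)) [0..<agents \<omega>]"

definition legal :: "nat option list \<Rightarrow> bool" where
  "legal os \<longleftrightarrow> (\<exists>y. \<forall>ov\<in>set os. ov = Some y)"

text \<open>Utility of agent \<open>a\<close> whose preferred output value is \<open>p\<close>.\<close>

definition utility :: "nat \<Rightarrow> nat \<Rightarrow> nat option list \<Rightarrow> real" where
  "utility p a os = (if os ! a = Some p \<and> legal os then 1 else 0)"

section \<open>Instances of $k$-Knowledge Sharing\<close>

text \<open>The random numbers of Secret-Transmit are uniform bit strings of length \<open>ks_bits S\<close>.\<close>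

record ks =
  ks_inputs :: "nat set"
  ks_bits :: nat
  ks_fun :: "nat list \<Rightarrow> nat"

definition ks_range :: "ks \<Rightarrow> nat set" where
  "ks_range S = ks_fun S ` {xs. xs \<noteq> [] \<and> set xs \<subseteq> ks_inputs S}"

definition full_knowledge :: "ks \<Rightarrow> bool" where
  "full_knowledge S \<longleftrightarrow>
     (\<forall>xs j. set xs \<subseteq> ks_inputs S \<and> j < length xs \<longrightarrow>
       (\<forall>y\<in>ks_range S. \<forall>z\<in>ks_range S.
          card {x \<in> ks_inputs S. ks_fun S (xs[j := x]) = y} =
          card {x \<in> ks_inputs S. ks_fun S (xs[j := x]) = z}))"

definition knowledge_sharing :: "nat \<Rightarrow> ks \<Rightarrow> bool" where
  "knowledge_sharing k S \<longleftrightarrow>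
     finite (ks_inputs S) \<and> ks_inputs S \<noteq> {} \<and> ks_inputs S \<subseteq> {..<2 ^ ks_bits S} \<and>
     card (ks_range S) = k \<and> full_knowledge S"

section \<open>The protocol Knowledge Sharing in a Ring\<close>

text \<open>
  A share whose receiver is \<open>D\<close> hops from its origin is sent in round \<open>0\<close>, forwarded in every round
  and held by the agent just before the receiver (\<open>j = D - 1\<close>) until round \<open>N - 1\<close>. An input is
  sent clockwise in round \<open>N + 1\<close> and forwarded in every round, so that it has reached all agents
  in round \<open>2N\<close>. \<open>due N p \<delta> t\<close> are the labels of the values that position \<open>p\<close> has to send in
  direction \<open>\<delta>\<close> in round \<open>t\<close>.
\<close>

definition due :: "nat \<Rightarrow> nat \<Rightarrow> dir \<Rightarrow> nat \<Rightarrow> tag set" where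
  "due N p \<delta> t =
     {Share k a | k a. a < N \<and> (let D = hops N \<delta> a (receiver_pos N k a); j = hops N \<delta> a p
        in j < D \<and> t = (if j + 1 < D then j else N - 1))} \<union>
     {Input a | a. a < N \<and> \<delta> = CW \<and> (let j = hops N CW a p in j + 1 < N \<and> t = N + 1 + j)}"

text \<open>The round in which a value to be forwarded reaches the position \<open>j\<close> hops from its origin.\<close>

definition arrival :: "nat \<Rightarrow> tag \<Rightarrow> nat \<Rightarrow> nat" where
  "arrival N \<tau> j = (case \<tau> of Share k a \<Rightarrow> j | Input a \<Rightarrow> N + 1 + j)"

definition own_value :: "local_info \<Rightarrow> dir \<Rightarrow> tag \<Rightarrow> nat" where
  "own_value i \<delta> \<tau> = (case \<tau> of
       Share k a \<Rightarrow> (case \<delta> of CW \<Rightarrow> coins i k | CCW \<Rightarrow> coins i k XOR input i)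
     | Input a \<Rightarrow> input i)"

definition protocol_send :: "local_info \<Rightarrow> history \<Rightarrow> dir \<Rightarrow> msg" where
  "protocol_send i h \<delta> =
     (let N = ring_size i; p = pos i; t = length h - 1 in
      (\<lambda>\<tau>. if \<tau> \<notin> due N p \<delta> t then None
           else if origin \<tau> = p then Some (own_value i \<delta> \<tau>)
           else (h ! arrival N \<tau> (hops N \<delta> (origin \<tau>) p)) \<delta> \<tau>))"

definition received_input :: "local_info \<Rightarrow> history \<Rightarrow> nat \<Rightarrow> nat" where
  "received_input i h a =
     (let N = ring_size i; p = pos i in
      if a = p then input i else the ((h ! arrival N (Input a) (hops N CW a p)) CW (Input a)))"

text \<open>
  Deviations an agent detects: a ring larger than \<open>\<beta>\<close>, a missing, untimely or superfluous value, an
  input outside the input set, and an announced input that differs from the one it has learnt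
  in round \<open>N\<close> as a receiver of a Secret-Transmit.
\<close>

definition accepts :: "nat \<Rightarrow> ks \<Rightarrow> local_info \<Rightarrow> history \<Rightarrow> bool" where
  "accepts \<beta> S i h \<longleftrightarrow>
     (let N = ring_size i; p = pos i in
      N \<le> \<beta> \<and>
      (\<forall>t \<le> 2 * N. \<forall>\<delta>. dom ((h ! t) \<delta>) =
         (if t = 0 then {} else due N (neighbour N (opp \<delta>) p) \<delta> (t - 1))) \<and>
      (\<forall>a < N. received_input i h a \<in> ks_inputs S) \<and>
      (\<forall>a < N. \<forall>k. receiver_pos N k a = p \<longrightarrow>
         the ((h ! N) CW (Share k a)) XOR the ((h ! N) CCW (Share k a)) = received_input i h a))"

definition protocol_result :: "nat \<Rightarrow> ks \<Rightarrow> local_info \<Rightarrow> history \<Rightarrow> nat option" where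
  "protocol_result \<beta> S i h =
     (if accepts \<beta> S i h then Some (ks_fun S (map (received_input i h) [0..<ring_size i])) else None)"

definition ring_protocol :: "nat \<Rightarrow> ks \<Rightarrow> strategy" where
  "ring_protocol \<beta> S = \<lparr>dup = 1, send = protocol_send, result = protocol_result \<beta> S\<rparr>"

section \<open>Distributed equilibrium\<close>

definition worlds :: "nat \<Rightarrow> nat \<Rightarrow> ks \<Rightarrow> world pmf" where
  "worlds \<alpha> \<beta> S = do {
     n \<leftarrow> geometric_prior \<alpha> \<beta>;
     f \<leftarrow> pmf_of_set {..<n};
     xs \<leftarrow> pmf_of_set {xs. set xs \<subseteq> ks_inputs S \<and> length xs = n};
     Rs \<leftarrow> pmf_of_set {Rs. set Rs \<subseteq> {R. \<forall>k. R k < 2 ^ ks_bits S} \<and> length Rs = n};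
     return_pmf \<lparr>agents = n, focal = f, inputs = xs, pads = Rs\<rparr>
   }"

datatype stage = Wake_Up | Round nat

text \<open>What the focal agent knows at a given stage if all agents have followed \<open>\<Lambda>\<close> so far. Before
  Wake-Up is completed it knows only its own input, in particular neither \<open>n\<close> nor its position.\<close>

definition view :: "strategy \<Rightarrow> stage \<Rightarrow> world \<Rightarrow> nat \<times> (local_info \<times> history) option" where
  "view \<Lambda> s \<omega> = (inputs \<omega> ! focal \<omega>,
     case s of Wake_Up \<Rightarrow> None | Round t \<Rightarrow> Some (info 1 \<omega> (focal \<omega>), hist \<Lambda> \<Lambda> \<omega> t (focal \<omega>)))"

text \<open>Strategies of an agent that has followed \<open>\<Lambda>\<close> before the given stage. The number of simulated
  agents is decided at the very beginning.\<close>

definition deviations :: "strategy \<Rightarrow> stage \<Rightarrow> strategy set" where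
  "deviations \<Lambda> s = (case s of
       Wake_Up \<Rightarrow> {\<sigma>. 1 \<le> dup \<sigma>}
     | Round t \<Rightarrow> {\<sigma>. dup \<sigma> = dup \<Lambda> \<and>
         (\<forall>i h. length h \<le> t \<longrightarrow> send \<sigma> i h = send \<Lambda> i h \<and> result \<sigma> i h = result \<Lambda> i h)})"

text \<open>Expected utility, as estimated with view \<open>v\<close> at stage \<open>s\<close>, of continuing with a strategy
  drawn at random from \<open>D\<close>.\<close>

definition expected_utility ::
    "strategy \<Rightarrow> world pmf \<Rightarrow> nat \<Rightarrow> stage \<Rightarrow> nat \<times> (local_info \<times> history) option \<Rightarrow>
     strategy pmf \<Rightarrow> real" where
  "expected_utility \<Lambda> W p s v D =
     measure_pmf.expectation (pair_pmf D (cond_pmf W {\<omega>. view \<Lambda> s \<omega> = v}))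
       (\<lambda>(\<sigma>, \<omega>). utility p (focal \<omega>) (outputs \<Lambda> \<sigma> \<omega>))"

text \<open>The preference \<open>p\<close> of the focal agent ranges over all possible output values; the preferences
  of the other agents play no role since they follow the algorithm.\<close>

definition distributed_equilibrium :: "strategy \<Rightarrow> nat \<Rightarrow> nat \<Rightarrow> ks \<Rightarrow> bool" where
  "distributed_equilibrium \<Lambda> \<alpha> \<beta> S \<longleftrightarrow>
     (\<forall>p \<in> ks_range S. \<forall>s. \<forall>v \<in> view \<Lambda> s ` set_pmf (worlds \<alpha> \<beta> S). \<forall>D.
        set_pmf D \<subseteq> deviations \<Lambda> s \<longrightarrow>
        expected_utility \<Lambda> (worlds \<alpha> \<beta> S) p s v D
          \<le> expected_utility \<Lambda> (worlds \<alpha> \<beta> S) p s v (return_pmf \<Lambda>))"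

end

(*
  Let the focal agent pretend to be d agents, so that N = n + d - 1. All honest agents accept only
  if the inputs announced for the simulated agents agree with what honest receivers have learnt from
  the Secret-Transmits, which is fixed by what was sent before round N.

  If beta <= 2 alpha - 1, a duplication that is not detected has d <= n. Then each simulated agent has
  an honest receiver, so all announced inputs are committed before round N, while the input of the
  counter-clockwise neighbour of the focal agent is still perfectly hidden from it: changing this input
  together with a pad leaves the view of the focal agent unchanged. By Full Knowledge the result is p
  for exactly one k-th of these changes. A deviation from round N on comes too late.

  If beta >= 2 alpha, pretend to be d = alpha + 1 agents. For n = alpha, both receivers of the first
  simulated agent are simulated, and its input is the last one to reach the honest agents, after all
  honest inputs are known; hence it can be chosen so that the result is p. This wins with
  probability at least Pr[n = alpha] > 1/2 >= 1/k.
*)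

theory Submission
  imports Defs
begin

section \<open>Schedules on the ring\<close>

text \<open>Expected utilities given a view are never computed. The worlds sharing an early view
  form a set closed under \<open>change_input\<close>, so it splits into orbits of equally likely
  worlds, one for each value of the hidden input. An honest agent wins exactly one k-th of each
  orbit and a deviation at most one k-th, so comparing unnormalised sums suffices.

  An arbitrary deviation can make runs irregular, so two runs of the same strategy are compared
  message by message, up to the few labels that may differ. Only the honest run and the cheating
  run, where every value is delivered on time, are described explicitly.

  The counter-clockwise neighbour of the focal agent has two roles. Its input is the one that stays
  hidden; and since inputs travel clockwise, it is the last honest agent to receive them, so what
  all honest agents are told about the simulated agents can be read off from this agent alone.

  The number \<alpha> + 1 is the least d for which, at n = \<alpha>, some simulated agent has no
  honest receiver: the ring then has 2 \<alpha> positions and the block reaches from its first agent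
  to the antipode.\<close>

lemma mod_less_double: "x < 2 * N \<Longrightarrow> x mod N = (if x < N then x else x - N)" for x N :: nat
  by (simp add: mod_if)

lemma hops_CW: "a < N \<Longrightarrow> b < N \<Longrightarrow> hops N CW a b = (if a \<le> b then b - a else b + N - a)"
  by (simp add: hops_def mod_less_double)

lemma hops_CCW: "a < N \<Longrightarrow> b < N \<Longrightarrow> hops N CCW a b = (if b \<le> a then a - b else a + N - b)"
  by (simp add: hops_def mod_less_double)

lemma neighbour_CW: "p < N \<Longrightarrow> neighbour N CW p = (if p + 1 < N then p + 1 else 0)"
  by (auto simp: neighbour_def mod_less_double)

lemma neighbour_CCW: "p < N \<Longrightarrow> neighbour N CCW p = (if p = 0 then N - 1 else p - 1)"
  by (auto simp: neighbour_def mod_less_double)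

lemma receiver_pos_B1: "a < N \<Longrightarrow> receiver_pos N B1 a = (if a + 1 < N then a + 1 else 0)"
  by (auto simp: mod_less_double)

lemma receiver_pos_B2:
  "a < N \<Longrightarrow> receiver_pos N B2 a =
     (if N div 2 = 0 then a else if N div 2 \<le> a then a - N div 2 else a + N - N div 2)"
  by (auto simp: mod_less_double)

lemmas ring_simps = hops_CW hops_CCW neighbour_CW neighbour_CCW receiver_pos_B1 receiver_pos_B2

lemma neighbour_less: "p < N \<Longrightarrow> neighbour N \<delta> p < N"
  by (cases \<delta>) (auto simp: ring_simps)

lemma receiver_pos_less: "a < N \<Longrightarrow> receiver_pos N k a < N"
  by (cases k) auto

lemma receiver_pos_neq: "a < N \<Longrightarrow> 2 \<le> N \<Longrightarrow> receiver_pos N k a \<noteq> a"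
  by (cases k) (auto simp del: receiver_pos.simps simp: ring_simps)

lemma hops_less: "a < N \<Longrightarrow> b < N \<Longrightarrow> hops N \<delta> a b < N"
  by (cases \<delta>) (auto simp: ring_simps)

lemma hops_neighbour:
  "a < N \<Longrightarrow> p < N \<Longrightarrow> a \<noteq> p \<Longrightarrow> hops N \<delta> a p = Suc (hops N \<delta> a (neighbour N (opp \<delta>) p))"
  by (cases \<delta>) (auto simp: ring_simps neighbour_less split: if_splits)

lemma due_origin_less: "\<tau> \<in> due N p \<delta> t \<Longrightarrow> origin \<tau> < N"
  by (auto simp: due_def)

lemma Share_due: "Share k a \<in> due N p \<delta> t \<longleftrightarrow>
   a < N \<and> hops N \<delta> a p < hops N \<delta> a (receiver_pos N k a) \<and>
   t = (if hops N \<delta> a p + 1 < hops N \<delta> a (receiver_pos N k a) then hops N \<delta> a p else N - 1)"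
  by (auto simp: due_def Let_def)

lemma Input_due: "Input a \<in> due N p \<delta> t \<longleftrightarrow>
   a < N \<and> \<delta> = CW \<and> hops N CW a p + 1 < N \<and> t = N + 1 + hops N CW a p"
  by (auto simp: due_def Let_def)

text \<open>A share is held back only at the last position before its receiver. The predecessor of
  \<open>p\<close> is not that position, so it forwards at once. A value that falls due has
  therefore already arrived, at the entry of the history where \<open>protocol_send\<close> looks it
  up.\<close>

lemma due_forward:
  assumes "\<tau> \<in> due N p \<delta> t" "origin \<tau> \<noteq> p" "p < N"
  shows "0 < arrival N \<tau> (hops N \<delta> (origin \<tau>) p)"
    and "arrival N \<tau> (hops N \<delta> (origin \<tau>) p) \<le> t"
    and "\<tau> \<in> due N (neighbour N (opp \<delta>) p) \<delta> (arrival N \<tau> (hops N \<delta> (origin \<tau>) p) - 1)"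
proof -
  have o: "origin \<tau> < N"
    using assms(1) by (rule due_origin_less)
  note h = hops_neighbour[OF o assms(3,2), of \<delta>]
  have r: "hops N \<delta> a (receiver_pos N k a) < N" if "a < N" for a k
    using that by (intro hops_less receiver_pos_less)
  show "0 < arrival N \<tau> (hops N \<delta> (origin \<tau>) p)"
    using h by (cases \<tau>) (auto simp: arrival_def)
  show "arrival N \<tau> (hops N \<delta> (origin \<tau>) p) \<le> t"
  proof (cases \<tau>)
    case (Share k a)
    then show ?thesis
      using assms(1) r[of a k] o by (auto simp: arrival_def Share_due split: if_splits)
  next
    case (Input a)
    then show ?thesis
      using assms(1) by (auto simp: arrival_def Input_due)
  qed
  show "\<tau> \<in> due N (neighbour N (opp \<delta>) p) \<delta> (arrival N \<tau> (hops N \<delta> (origin \<tau>) p) - 1)"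
    using assms(1) h by (cases \<tau>) (auto simp: arrival_def Share_due Input_due split: if_splits)
qed

section \<open>Histories and runs in which every value is on time\<close>

lemma length_hist [simp]: "length (hist \<Lambda> \<sigma> \<omega> t b) = Suc t"
  by (induction t) auto

lemma hist_nth: "s \<le> t \<Longrightarrow> hist \<Lambda> \<sigma> \<omega> t b ! s = hist \<Lambda> \<sigma> \<omega> s b ! s"
  by (induction t) (auto simp: nth_append le_Suc_eq)

lemma hist_nth_Suc:
  "Suc s \<le> t \<Longrightarrow> (hist \<Lambda> \<sigma> \<omega> t b ! Suc s) \<delta> =
     (let c = neighbour (agents \<omega>) (opp \<delta>) b
      in send (strategy_of \<Lambda> \<sigma> \<omega> c) (info (dup \<sigma>) \<omega> c) (hist \<Lambda> \<sigma> \<omega> s c) \<delta>)"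
  by (subst hist_nth) (auto simp: nth_append)

text \<open>\<open>val \<delta> \<tau>\<close> is the value that label \<open>\<tau>\<close> carries in direction \<open>\<delta>\<close> throughout the run, whether its
  origin is honest or simulated; \<open>entry \<delta>\<close> is the position at which the agent receives what travels
  in direction \<open>\<delta>\<close>.\<close>

definition scheduled :: "nat \<Rightarrow> (dir \<Rightarrow> tag \<Rightarrow> nat) \<Rightarrow> nat \<Rightarrow> dir \<Rightarrow> nat \<Rightarrow> msg" where
  "scheduled N val p \<delta> t = (\<lambda>\<tau>. if \<tau> \<in> due N p \<delta> t then Some (val \<delta> \<tau>) else None)"

definition on_schedule :: "nat \<Rightarrow> (dir \<Rightarrow> tag \<Rightarrow> nat) \<Rightarrow> (dir \<Rightarrow> nat) \<Rightarrow> history \<Rightarrow> bool" where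
  "on_schedule N val entry h \<longleftrightarrow> (\<forall>s < length h. \<forall>\<delta>. (h ! s) \<delta> =
     (if s = 0 then Map.empty else scheduled N val (neighbour N (opp \<delta>) (entry \<delta>)) \<delta> (s - 1)))"

lemma on_schedule_arrival:
  assumes "on_schedule N val entry h" "length h = Suc t"
    "\<tau> \<in> due N (entry \<delta>) \<delta> t'" "t' \<le> t" "origin \<tau> \<noteq> entry \<delta>" "entry \<delta> < N"
  shows "(h ! arrival N \<tau> (hops N \<delta> (origin \<tau>) (entry \<delta>))) \<delta> \<tau> = Some (val \<delta> \<tau>)"
  using assms(1,2,4) due_forward[OF assms(3,5,6)] by (auto simp: on_schedule_def scheduled_def)

lemma protocol_send_on_schedule:
  assumes "on_schedule N val (\<lambda>_. p) h" "length h = Suc t" "ring_size i = N" "pos i = p" "p < N"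
    and "\<And>\<delta> \<tau>. origin \<tau> = p \<Longrightarrow> val \<delta> \<tau> = own_value i \<delta> \<tau>"
  shows "protocol_send i h \<delta> = scheduled N val p \<delta> t"
  using assms on_schedule_arrival[OF assms(1,2)]
  by (auto simp: protocol_send_def scheduled_def Let_def)

lemma Share_due_receiver:
  assumes "a < N" "2 \<le> N" "receiver_pos N k a = p"
  shows "Share k a \<in> due N (neighbour N (opp \<delta>) p) \<delta> (N - 1)"
proof -
  have "p < N" "p \<noteq> a"
    using assms receiver_pos_less[of a N k] receiver_pos_neq[of a N k] by auto
  then show ?thesis
    using assms hops_neighbour[of a N p \<delta>] by (auto simp: Share_due)
qed

lemma Input_due_receive:
  assumes "a < N" "p < N" "a \<noteq> p"
  shows "Input a \<in> due N (neighbour N CCW p) CW (N + hops N CW a p)"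
  using assms hops_neighbour[of a N p CW] hops_less[of a N p CW] by (auto simp: Input_due)

lemma received_input_on_schedule:
  assumes h: "on_schedule N val (\<lambda>_. p) h" "length h = Suc (2 * N)"
    and i: "ring_size i = N" "pos i = p" "p < N" "input i = val CW (Input p)" and "a < N"
  shows "received_input i h a = val CW (Input a)"
  using assms Input_due_receive[of a N p] hops_less[of a N p CW]
  by (auto simp: received_input_def Let_def arrival_def on_schedule_def scheduled_def)

text \<open>Shares have to match the announced input only where \<open>p\<close> is their receiver.
  This is the gap through which the cheating run slips: shares between simulated agents are tested
  by nobody.\<close>

lemma protocol_result_on_schedule:
  assumes h: "on_schedule N val (\<lambda>_. p) h" "length h = Suc (2 * N)"
    and i: "ring_size i = N" "pos i = p" "p < N" "input i = val CW (Input p)"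
    and N: "2 \<le> N" "N \<le> \<beta>"
    and inp: "\<And>a. a < N \<Longrightarrow> val CW (Input a) \<in> ks_inputs S"
    and shares: "\<And>k a. a < N \<Longrightarrow> receiver_pos N k a = p \<Longrightarrow>
       val CW (Share k a) XOR val CCW (Share k a) = val CW (Input a)"
  shows "protocol_result \<beta> S i h = Some (ks_fun S (map (\<lambda>a. val CW (Input a)) [0..<N]))"
proof -
  note r = received_input_on_schedule[OF h i]
  have s: "(h ! N) \<delta> (Share k a) = Some (val \<delta> (Share k a))"
    if "a < N" "receiver_pos N k a = p" for k a \<delta>
    using h N Share_due_receiver[OF that(1) N(1) that(2), of \<delta>]
    by (auto simp: on_schedule_def scheduled_def)
  have "dom ((h ! t) \<delta>) = (if t = 0 then {} else due N (neighbour N (opp \<delta>) p) \<delta> (t - 1))"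
    if "t \<le> 2 * N" for t \<delta>
    using h that by (auto simp: on_schedule_def scheduled_def dom_def)
  then have "accepts \<beta> S i h"
    unfolding accepts_def Let_def i(1,2) using N inp r s shares by simp
  then show ?thesis
    using i r by (auto simp: protocol_result_def intro!: arg_cong[where f="ks_fun S"])
qed

lemma dup_ring_protocol [simp]: "dup (ring_protocol \<beta> S) = 1"
  and send_ring_protocol [simp]: "send (ring_protocol \<beta> S) = protocol_send"
  and result_ring_protocol [simp]: "result (ring_protocol \<beta> S) = protocol_result \<beta> S"
  by (simp_all add: ring_protocol_def)

lemma ring_size_info [simp]: "ring_size (info d \<omega> b) = agents \<omega> + d - 1"
  and pos_info: "pos (info d \<omega> b) = (if b \<le> focal \<omega> then b else b + d - 1)"
  and input_info [simp]: "input (info d \<omega> b) = inputs \<omega> ! b"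
  and coins_info [simp]: "coins (info d \<omega> b) = pads \<omega> ! b"
  by (simp_all add: info_def)

text \<open>Messages in direction \<open>\<delta>\<close> enter the block \<open>p, \<dots>, p + d - 1\<close> at \<open>entry d p \<delta>\<close> and leave it at
  \<open>entry d p (opp \<delta>)\<close>.\<close>

definition entry :: "nat \<Rightarrow> nat \<Rightarrow> dir \<Rightarrow> nat" where
  "entry d p \<delta> = (case \<delta> of CW \<Rightarrow> p | CCW \<Rightarrow> p + d - 1)"

lemma entry_1 [simp]: "entry 1 p = (\<lambda>_. p)" "entry (Suc 0) p = (\<lambda>_. p)"
  by (auto simp: entry_def split: dir.splits)

text \<open>Every real agent counts as a block, honest ones as blocks of one position, so that a
  single induction over the rounds treats all agents alike.\<close>

definition width :: "nat \<Rightarrow> world \<Rightarrow> nat \<Rightarrow> nat" where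
  "width d \<omega> b = (if b = focal \<omega> then d else 1)"

lemma neighbour_entry:
  assumes "b < agents \<omega>" "focal \<omega> < agents \<omega>" "2 \<le> agents \<omega>" "1 \<le> d"
  shows "neighbour (agents \<omega> + d - 1) (opp \<delta>) (entry (width d \<omega> b) (pos (info d \<omega> b)) \<delta>) =
    (let c = neighbour (agents \<omega>) (opp \<delta>) b
     in entry (width d \<omega> c) (pos (info d \<omega> c)) (opp \<delta>))"
  using assms
  by (cases \<delta>) (auto simp: entry_def width_def pos_info ring_simps Let_def split: if_splits)

lemma pos_info_less:
  "b < agents \<omega> \<Longrightarrow> 1 \<le> d \<Longrightarrow> pos (info d \<omega> b) < agents \<omega> + d - 1"
  by (auto simp: pos_info)

text \<open>The premise on \<open>send\<close> is local: whoever has received on schedule sends on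
  schedule. Both the honest run and the cheating run are instances.\<close>

lemma on_schedule_hist:
  assumes \<omega>: "focal \<omega> < agents \<omega>" "2 \<le> agents \<omega>" "1 \<le> dup \<sigma>"
    and send: "\<And>b h t \<delta>. b < agents \<omega> \<Longrightarrow> length h = Suc t \<Longrightarrow>
       on_schedule N val (entry (width (dup \<sigma>) \<omega> b) (pos (info (dup \<sigma>) \<omega> b))) h \<Longrightarrow>
       send (strategy_of \<Lambda> \<sigma> \<omega> b) (info (dup \<sigma>) \<omega> b) h \<delta> =
         scheduled N val (entry (width (dup \<sigma>) \<omega> b) (pos (info (dup \<sigma>) \<omega> b)) (opp \<delta>)) \<delta> t"
    and N: "N = agents \<omega> + dup \<sigma> - 1" and "b < agents \<omega>"
  shows "on_schedule N val (entry (width (dup \<sigma>) \<omega> b) (pos (info (dup \<sigma>) \<omega> b))) (hist \<Lambda> \<sigma> \<omega> t b)"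
  using \<open>b < agents \<omega>\<close>
proof (induction t arbitrary: b)
  case 0
  then show ?case
    by (simp add: on_schedule_def)
next
  case (Suc t)
  have "(hist \<Lambda> \<sigma> \<omega> (Suc t) b ! s) \<delta> = (if s = 0 then Map.empty else
     scheduled N val (neighbour N (opp \<delta>) (entry (width (dup \<sigma>) \<omega> b) (pos (info (dup \<sigma>) \<omega> b)) \<delta>)) \<delta> (s - 1))"
    if "s \<le> Suc t" for s \<delta>
  proof (cases "s = Suc t")
    case True
    define c where "c = neighbour (agents \<omega>) (opp \<delta>) b"
    have c: "c < agents \<omega>"
      using Suc.prems by (simp add: c_def neighbour_less)
    show ?thesis
      using send[OF c _ Suc.IH[OF c], of t] neighbour_entry[OF Suc.prems \<omega>, of \<delta>]
      by (simp add: True hist_nth_Suc N Let_def flip: c_def del: hist.simps)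
  next
    case False
    then have "s \<le> t"
      using that by simp
    then have "hist \<Lambda> \<sigma> \<omega> (Suc t) b ! s = hist \<Lambda> \<sigma> \<omega> t b ! s"
      by (metis hist_nth le_SucI)
    then show ?thesis
      using \<open>s \<le> t\<close> Suc.IH[OF Suc.prems] by (simp add: on_schedule_def del: hist.simps)
  qed
  then show ?case
    by (auto simp: on_schedule_def simp del: hist.simps)
qed

section \<open>Runs with one deviating agent\<close>

lemma pos_info_1 [simp]: "pos (info 1 \<omega> b) = b" "pos (info (Suc 0) \<omega> b) = b"
  by (simp_all add: pos_info)

lemma width_1 [simp]: "width 1 \<omega> b = 1" "width (Suc 0) \<omega> b = 1"
  by (simp_all add: width_def)

lemma honest_hist:
  assumes "focal \<omega> < agents \<omega>" "2 \<le> agents \<omega>" "b < agents \<omega>"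
  shows "on_schedule (agents \<omega>) (\<lambda>\<delta> \<tau>. own_value (info 1 \<omega> (origin \<tau>)) \<delta> \<tau>) (\<lambda>_. b)
    (hist (ring_protocol \<beta> S) (ring_protocol \<beta> S) \<omega> t b)"
proof -
  have "on_schedule (agents \<omega>) (\<lambda>\<delta> \<tau>. own_value (info 1 \<omega> (origin \<tau>)) \<delta> \<tau>)
    (entry (width 1 \<omega> b) (pos (info 1 \<omega> b))) (hist (ring_protocol \<beta> S) (ring_protocol \<beta> S) \<omega> t b)"
    using assms
    by (intro on_schedule_hist[where \<sigma>="ring_protocol \<beta> S", unfolded dup_ring_protocol])
       (auto simp: strategy_of_def intro!: protocol_send_on_schedule)
  then show ?thesis
    by simp
qed

lemma own_value_xor:
  "own_value i CW (Share k a) XOR own_value i CCW (Share k a) = own_value i \<delta> (Input a)"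
  by (simp add: own_value_def flip: xor.assoc)

lemma honest_result:
  assumes "focal \<omega> < agents \<omega>" "2 \<le> agents \<omega>" "b < agents \<omega>" "agents \<omega> \<le> \<beta>"
    "length (inputs \<omega>) = agents \<omega>" "set (inputs \<omega>) \<subseteq> ks_inputs S"
  shows "protocol_result \<beta> S (info 1 \<omega> b)
     (hist (ring_protocol \<beta> S) (ring_protocol \<beta> S) \<omega> (2 * agents \<omega>) b) = Some (ks_fun S (inputs \<omega>))"
proof -
  have "map (\<lambda>a. own_value (info 1 \<omega> a) CW (Input a)) [0..<agents \<omega>] = inputs \<omega>"
    using assms(5) by (intro nth_equalityI) (auto simp: own_value_def)
  moreover have "inputs \<omega> ! a \<in> ks_inputs S" if "a < agents \<omega>" for a
    using assms(5,6) that by (metis nth_mem subsetD)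
  ultimately show ?thesis
    using protocol_result_on_schedule[OF honest_hist[OF assms(1-3), where t="2 * agents \<omega>"], where i="info 1 \<omega> b" and \<beta>=\<beta> and S=S]
      assms own_value_xor by (simp add: pos_info) (simp add: own_value_def)
qed

lemma honest_utility:
  assumes "focal \<omega> < agents \<omega>" "2 \<le> agents \<omega>" "agents \<omega> \<le> \<beta>"
    "length (inputs \<omega>) = agents \<omega>" "set (inputs \<omega>) \<subseteq> ks_inputs S"
  shows "utility p (focal \<omega>) (outputs (ring_protocol \<beta> S) (ring_protocol \<beta> S) \<omega>) =
    of_bool (ks_fun S (inputs \<omega>) = p)"
proof -
  have "outputs (ring_protocol \<beta> S) (ring_protocol \<beta> S) \<omega> =
      map (\<lambda>b. Some (ks_fun S (inputs \<omega>))) [0..<agents \<omega>]"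
    using honest_result[OF assms(1,2) _ assms(3-5)] by (auto simp: outputs_def strategy_of_def)
  then show ?thesis
    using assms(1) by (auto simp: utility_def legal_def)
qed

lemma hist_cong:
  assumes "dup \<sigma> = dup \<Lambda>" "\<And>i h. length h \<le> t \<Longrightarrow> send \<sigma> i h = send \<Lambda> i h" "s \<le> t"
  shows "hist \<Lambda> \<sigma> \<omega> s b = hist \<Lambda> \<Lambda> \<omega> s b"
  using assms(3) by (induction s arbitrary: b) (auto simp: assms(1,2) strategy_of_def Let_def)

section \<open>How announced inputs pass between honest agents\<close>

lemma pos_neighbour:
  assumes "b < agents \<omega>" "focal \<omega> < agents \<omega>" "2 \<le> agents \<omega>" "1 \<le> d"
    and "b \<noteq> focal \<omega>" "neighbour (agents \<omega>) (opp \<delta>) b \<noteq> focal \<omega>"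
  shows "neighbour (agents \<omega> + d - 1) (opp \<delta>) (pos (info d \<omega> b)) =
    pos (info d \<omega> (neighbour (agents \<omega>) (opp \<delta>) b))"
  using neighbour_entry[OF assms(1-4), of \<delta>] assms(5,6) by (simp add: width_def Let_def)

text \<open>Honest agents forward an input exactly as they received it, true or not. A missing value
  does no harm, since both sides apply \<open>the\<close> to the same optional value.\<close>

lemma received_input_neighbour:
  fixes \<sigma> \<omega> \<beta> S
  defines "d \<equiv> dup \<sigma>"
  defines "N \<equiv> agents \<omega> + d - 1"
  defines "r \<equiv> \<lambda>b. received_input (info d \<omega> b) (hist (ring_protocol \<beta> S) \<sigma> \<omega> (2 * N) b)"
  assumes "b < agents \<omega>" "focal \<omega> < agents \<omega>" "2 \<le> agents \<omega>" "1 \<le> d"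
    and "b \<noteq> focal \<omega>" "neighbour (agents \<omega>) CCW b \<noteq> focal \<omega>" "a < N" "a \<noteq> pos (info d \<omega> b)"
  shows "r b a = r (neighbour (agents \<omega>) CCW b) a"
proof -
  define c where "c = neighbour (agents \<omega>) CCW b"
  have c: "c < agents \<omega>" "c \<noteq> focal \<omega>"
    using assms by (auto simp: c_def neighbour_less)
  have pc: "neighbour N CCW (pos (info d \<omega> b)) = pos (info d \<omega> c)"
    using pos_neighbour[of b \<omega> d CW] assms by (simp add: c_def)
  have rs: "ring_size (info d \<omega> x) = N" for x
    by (simp add: N_def)
  define J where "J = hops N CW a (pos (info d \<omega> c))"
  have pb: "pos (info d \<omega> b) < N"
    using pos_info_less[OF assms(4,7)] by (simp add: N_def)
  have J: "hops N CW a (pos (info d \<omega> b)) = Suc J"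
    using hops_neighbour[OF assms(10) pb assms(11), of CW] pc by (simp add: J_def)
  then have J1: "Suc J < N"
    using hops_less[OF assms(10) pb, of CW] by simp
  define t where "t = N + 1 + J"
  have "r b a = the ((hist (ring_protocol \<beta> S) \<sigma> \<omega> (2 * N) b ! Suc t) CW (Input a))"
    using assms(11) J by (simp add: r_def received_input_def Let_def arrival_def t_def rs del: ring_size_info)
  also have "\<dots> = the (protocol_send (info d \<omega> c) (hist (ring_protocol \<beta> S) \<sigma> \<omega> t c) CW (Input a))"
    using J1 c by (subst hist_nth_Suc) (auto simp: t_def c_def d_def strategy_of_def Let_def)
  also have "\<dots> = r c a"
    using J1 \<open>a < N\<close>
    by (auto simp: r_def protocol_send_def received_input_def Let_def Input_due t_def J_def own_value_def
         arrival_def hist_nth rs simp del: ring_size_info)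
  finally show ?thesis
    by (simp add: c_def)
qed

lemma pos_info_inj:
  "pos (info d \<omega> b) = pos (info d \<omega> b') \<Longrightarrow> 1 \<le> d \<Longrightarrow> b = b'"
  by (auto simp: pos_info split: if_splits)

lemma pos_info_honest:
  "b \<noteq> focal \<omega> \<Longrightarrow> 1 \<le> d \<Longrightarrow> pos (info d \<omega> b) \<notin> {focal \<omega>..<focal \<omega> + d}"
  by (auto simp: pos_info split: if_splits)

lemma honest_position:
  assumes "focal \<omega> < agents \<omega>" "p < agents \<omega> + d - 1" "p \<notin> {focal \<omega>..<focal \<omega> + d}" "1 \<le> d"
  obtains b where "b < agents \<omega>" "b \<noteq> focal \<omega>" "p = pos (info d \<omega> b)"
proof (cases "p < focal \<omega>")
  case True
  with assms show ?thesis
    by (intro that[of p]) (auto simp: pos_info)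
next
  case False
  with assms show ?thesis
    by (intro that[of "p - (d - 1)"]) (auto simp: pos_info)
qed

text \<open>Inputs travel clockwise, so the last honest agent on their way round receives the true inputs
  of all honest agents, and of the focal agent what all honest agents receive.\<close>

lemma received_input_last:
  fixes \<sigma> \<omega> \<beta> S
  defines "d \<equiv> dup \<sigma>"
  defines "N \<equiv> agents \<omega> + d - 1"
  defines "r \<equiv> \<lambda>b. received_input (info d \<omega> b) (hist (ring_protocol \<beta> S) \<sigma> \<omega> (2 * N) b)"
  assumes "focal \<omega> < agents \<omega>" "2 \<le> agents \<omega>" "1 \<le> d" "b < agents \<omega>" "b \<noteq> focal \<omega>"
  shows "r (neighbour (agents \<omega>) CCW (focal \<omega>)) (pos (info d \<omega> b)) = inputs \<omega> ! b"
    and "a \<in> {focal \<omega>..<focal \<omega> + d} \<Longrightarrow> r (neighbour (agents \<omega>) CCW (focal \<omega>)) a = r b a"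
proof -
  define n f where "n = agents \<omega>" and "f = focal \<omega>"
  \<comment> \<open>The agents in the order in which an input leaving the focal agent meets them:
    \<open>A 0\<close> is the focal agent, \<open>A (n - 1)\<close> its counter-clockwise neighbour.
    The path from \<open>A 1\<close> to \<open>A (n - 1)\<close> avoids the focal agent.\<close>
  define A where "A u = (f + u) mod n" for u
  have n: "f < n" "2 \<le> n"
    using assms(4,5) by (simp_all add: n_def f_def)
  have A: "A u < n" "A u \<noteq> f" if "1 \<le> u" "u < n" for u
    using n that by (auto simp: A_def mod_less_double)
  have A_Suc: "neighbour n CCW (A (Suc u)) = A u" if "Suc u < n" for u
    using n that by (auto simp: A_def neighbour_def mod_less_double)
  have inj: "A u \<noteq> A v" if "u < v" "v < n" for u v
    using n that by (auto simp: A_def mod_less_double)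
  have receive: "r (A (Suc u)) a = r (A u) a"
    if "1 \<le> u" "Suc u < n" "a < N" "a \<noteq> pos (info d \<omega> (A (Suc u)))" for u a
    using received_input_neighbour[of "A (Suc u)" \<omega> \<sigma> a \<beta> S, folded d_def, folded N_def]
      A[of "Suc u"] A[of u] A_Suc[of u] that n \<open>1 \<le> d\<close>
    by (simp add: r_def n_def f_def)
  have own: "r b (pos (info d \<omega> b)) = inputs \<omega> ! b" for b
    by (simp add: r_def received_input_def)
  have true: "r (A u) (pos (info d \<omega> (A v))) = inputs \<omega> ! A v" if "1 \<le> v" "v \<le> u" "u < n" for u v
    using that(2,3)
  proof (induction u rule: dec_induct)
    case base
    then show ?case by (simp add: own)
  next
    case (step u)
    then have "pos (info d \<omega> (A v)) \<noteq> pos (info d \<omega> (A (Suc u)))"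
      using inj[of v "Suc u"] \<open>1 \<le> d\<close> by (metis less_Suc_eq_le pos_info_inj)
    moreover have "pos (info d \<omega> (A v)) < N"
      using step pos_info_less[of "A v" \<omega> d] A[of v] \<open>1 \<le> v\<close> \<open>1 \<le> d\<close> by (simp add: n_def N_def)
    ultimately show ?case
      using step \<open>1 \<le> v\<close> receive[of u "pos (info d \<omega> (A v))"] by simp
  qed
  have same: "r (A u) a = r (A 1) a" if "1 \<le> u" "u < n" "a \<in> {f..<f + d}" for u a
    using that(1,2)
  proof (induction u rule: dec_induct)
    case (step u)
    have "a < N" "a \<noteq> pos (info d \<omega> (A (Suc u)))"
      using pos_info_honest[of "A (Suc u)" \<omega> d] A[of "Suc u"] step that n \<open>1 \<le> d\<close> by (auto simp: N_def n_def f_def)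
    with step show ?case
      using receive[of u a] by simp
  qed simp
  have last: "neighbour (agents \<omega>) CCW (focal \<omega>) = A (n - 1)"
    using n by (auto simp: A_def neighbour_def n_def f_def)
  define v where "v = (if f < b then b - f else b + n - f)"
  have v: "b = A v" "1 \<le> v" "v \<le> n - 1"
    using assms(7,8) n by (auto simp: A_def v_def mod_less_double n_def f_def)
  show "r (neighbour (agents \<omega>) CCW (focal \<omega>)) (pos (info d \<omega> b)) = inputs \<omega> ! b"
    using true[of v "n - 1"] v n by (simp add: last)
  show "r (neighbour (agents \<omega>) CCW (focal \<omega>)) a = r b a" if "a \<in> {focal \<omega>..<focal \<omega> + d}"
    using same[of "n - 1" a] same[of v a] v n that by (simp add: last f_def)
qed

definition learnt_input :: "nat \<Rightarrow> history \<Rightarrow> receiver \<Rightarrow> nat \<Rightarrow> nat" where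
  "learnt_input N h k a = the ((h ! N) CW (Share k a)) XOR the ((h ! N) CCW (Share k a))"

text \<open>A positive utility needs a legal output, so all honest agents accept, and by
  \<open>received_input_last\<close> all their tests become statements about the inputs received by
  \<open>c\<close>. A simulated input is tied down only if one of its receivers is honest.\<close>

lemma winning_run:
  fixes \<sigma> \<omega> \<beta> S
  defines "d \<equiv> dup \<sigma>"
  defines "N \<equiv> agents \<omega> + d - 1"
  defines "h \<equiv> hist (ring_protocol \<beta> S) \<sigma> \<omega> (2 * N)"
  defines "c \<equiv> neighbour (agents \<omega>) CCW (focal \<omega>)"
  assumes "focal \<omega> < agents \<omega>" "2 \<le> agents \<omega>" "1 \<le> d"
    and win: "utility p (focal \<omega>) (outputs (ring_protocol \<beta> S) \<sigma> \<omega>) \<noteq> 0"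
  shows "N \<le> \<beta>"
    and "ks_fun S (map (received_input (info d \<omega> c) (h c)) [0..<N]) = p"
    and "\<And>a. a < N \<Longrightarrow> received_input (info d \<omega> c) (h c) a \<in> ks_inputs S"
    and "\<And>b. b < agents \<omega> \<Longrightarrow> b \<noteq> focal \<omega> \<Longrightarrow>
       received_input (info d \<omega> c) (h c) (pos (info d \<omega> b)) = inputs \<omega> ! b"
    and "\<And>a b k. a \<in> {focal \<omega>..<focal \<omega> + d} \<Longrightarrow> b < agents \<omega> \<Longrightarrow> b \<noteq> focal \<omega> \<Longrightarrow>
       receiver_pos N k a = pos (info d \<omega> b) \<Longrightarrow>
       received_input (info d \<omega> c) (h c) a = learnt_input N (h b) k a"
proof -
  have c: "c < agents \<omega>" "c \<noteq> focal \<omega>"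
    using assms by (auto simp: c_def neighbour_less neighbour_CCW)
  have res: "protocol_result \<beta> S (info d \<omega> b) (h b) = Some p" if "b < agents \<omega>" "b \<noteq> focal \<omega>" for b
    using win that \<open>focal \<omega> < agents \<omega>\<close>
    by (auto simp: utility_def legal_def outputs_def strategy_of_def d_def h_def N_def split: if_splits)
  have acc: "accepts \<beta> S (info d \<omega> b) (h b)" if "b < agents \<omega>" "b \<noteq> focal \<omega>" for b
    using res[OF that] by (auto simp: protocol_result_def split: if_splits)
  show "N \<le> \<beta>" "\<And>a. a < N \<Longrightarrow> received_input (info d \<omega> c) (h c) a \<in> ks_inputs S"
    using acc[OF c] by (auto simp: accepts_def Let_def N_def)
  show "ks_fun S (map (received_input (info d \<omega> c) (h c)) [0..<N]) = p"
    using res[OF c] by (auto simp: protocol_result_def N_def split: if_splits)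
  note last = received_input_last[where \<sigma>=\<sigma> and \<omega>=\<omega> and \<beta>=\<beta> and S=S, folded d_def N_def h_def c_def, OF assms(5-7)]
  show "received_input (info d \<omega> c) (h c) (pos (info d \<omega> b)) = inputs \<omega> ! b"
    if "b < agents \<omega>" "b \<noteq> focal \<omega>" for b
    using last(1)[OF that] by (simp add: h_def N_def)
  show "received_input (info d \<omega> c) (h c) a = learnt_input N (h b) k a"
    if "a \<in> {focal \<omega>..<focal \<omega> + d}" "b < agents \<omega>" "b \<noteq> focal \<omega>"
      "receiver_pos N k a = pos (info d \<omega> b)" for a b k
    using last(2)[OF that(2,3,1)] acc[OF that(2,3)] that assms(5-7)
    by (auto simp: accepts_def Let_def learnt_input_def N_def h_def)
qed

section \<open>Changing the hidden input\<close>

text \<open>The agent whose input stays hidden from the focal agent until round \<open>N\<close>. The new pad keeps the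
  value \<open>X\<close> of its first Secret-Transmit, which passes through the focal agent, unchanged; in the
  second one it is \<open>R\<close> that passes, so that pad is kept.\<close>

definition hidden :: "world \<Rightarrow> nat" where
  "hidden \<omega> = neighbour (agents \<omega>) CCW (focal \<omega>)"

definition change_input :: "nat \<Rightarrow> world \<Rightarrow> world" where
  "change_input x \<omega> = \<omega>\<lparr>inputs := (inputs \<omega>)[hidden \<omega> := x],
     pads := (pads \<omega>)[hidden \<omega> := (pads \<omega> ! hidden \<omega>)
       (B1 := (pads \<omega> ! hidden \<omega>) B1 XOR inputs \<omega> ! hidden \<omega> XOR x)]\<rparr>"

lemma agents_change_input [simp]: "agents (change_input x \<omega>) = agents \<omega>"
  and focal_change_input [simp]: "focal (change_input x \<omega>) = focal \<omega>"
  and hidden_change_input [simp]: "hidden (change_input x \<omega>) = hidden \<omega>"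
  by (simp_all add: change_input_def hidden_def)

lemma inputs_change_input: "inputs (change_input x \<omega>) = (inputs \<omega>)[hidden \<omega> := x]"
  by (simp add: change_input_def)

lemma pos_change_input [simp]: "pos (info d (change_input x \<omega>) b) = pos (info d \<omega> b)"
  by (simp add: pos_info)

lemma info_change_input:
  "b \<noteq> hidden \<omega> \<Longrightarrow> info d (change_input x \<omega>) b = info d \<omega> b"
  by (simp add: info_def change_input_def)

lemma hidden_less: "focal \<omega> < agents \<omega> \<Longrightarrow> hidden \<omega> < agents \<omega>"
  by (simp add: hidden_def neighbour_less)

lemma neighbour_focal_neq:
  "focal \<omega> < agents \<omega> \<Longrightarrow> 2 \<le> agents \<omega> \<Longrightarrow> neighbour (agents \<omega>) \<delta> (focal \<omega>) \<noteq> focal \<omega>"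
  by (cases \<delta>) (auto simp: ring_simps)

lemma hidden_neq: "focal \<omega> < agents \<omega> \<Longrightarrow> 2 \<le> agents \<omega> \<Longrightarrow> hidden \<omega> \<noteq> focal \<omega>"
  by (simp add: hidden_def neighbour_focal_neq)

lemma pos_neighbour_focal:
  assumes "focal \<omega> < agents \<omega>" "2 \<le> agents \<omega>" "1 \<le> d"
  shows "neighbour (agents \<omega> + d - 1) (opp \<delta>) (entry d (focal \<omega>) \<delta>) =
    pos (info d \<omega> (neighbour (agents \<omega>) (opp \<delta>) (focal \<omega>)))"
proof -
  have "pos (info d \<omega> (focal \<omega>)) = focal \<omega>"
    by (simp add: pos_info)
  then show ?thesis
    using neighbour_entry[OF assms(1) assms, of \<delta>] neighbour_focal_neq[OF assms(1,2)]
    by (simp add: width_def Let_def)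
qed

lemma hops_receiver_B1: "a < N \<Longrightarrow> 2 \<le> N \<Longrightarrow> hops N CW a (receiver_pos N B1 a) = 1"
  by (auto simp: receiver_pos_B1 hops_CW simp del: receiver_pos.simps)

lemma hops_receiver_B2: "a < N \<Longrightarrow> 2 \<le> N \<Longrightarrow> hops N CCW a (receiver_pos N B2 a) = N div 2"
  by (auto simp: receiver_pos_B2 hops_CCW simp del: receiver_pos.simps)

text \<open>The only values that depend on the changed input before round \<open>N\<close>. The focal agent cannot receive
  them earlier: the first is held by its origin, whose clockwise neighbour is the focal agent; the
  second travels \<open>N div 2 \<le> N - d\<close> hops, so it reaches the focal agent at best as its receiver.\<close>

definition affected :: "nat \<Rightarrow> (dir \<times> tag) set" where
  "affected p = {(CW, Share B1 p), (CCW, Share B2 p)}"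

lemma affected_not_due:
  assumes "f < n" "2 \<le> n" "1 \<le> d" "d \<le> n" "N = n + d - 1" "t < N - 1"
    and "(\<delta>, \<tau>) \<in> affected (neighbour N CCW f)"
  shows "\<tau> \<notin> due N (neighbour N (opp \<delta>) (entry d f \<delta>)) \<delta> t"
proof -
  define p where "p = neighbour N CCW f"
  have p: "p = (if f = 0 then N - 1 else f - 1)" "p < N"
    using assms(1-5) by (auto simp: p_def ring_simps)
  show ?thesis
  proof (cases \<delta>)
    case CW
    then have "\<tau> = Share B1 p"
      using assms(7) by (auto simp: affected_def p_def)
    moreover have "hops N CW p p = 0" "hops N CW p (receiver_pos N B1 p) = 1"
      using hops_receiver_B1[OF p(2)] p(2) assms(1-5) by (simp_all add: hops_CW)
    ultimately show ?thesis
      using CW assms(6) by (auto simp: Share_due entry_def simp flip: p_def simp del: receiver_pos.simps)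
  next
    case CCW
    define e where "e = (if f + d < N then f + d else 0)"
    have e: "neighbour N CW (f + d - 1) = e" "e < N"
      using assms(1-5) by (auto simp: e_def neighbour_CW)
    have "\<tau> = Share B2 p"
      using assms(7) CCW by (auto simp: affected_def p_def)
    moreover have "hops N CCW p e = N - d - 1"
    proof -
      have "f = n - 1" if "\<not> f + d < N"
        using that assms(1-5) by linarith
      then show ?thesis
        using p e assms(1-6) by (auto simp: hops_CCW e_def numeral_2_eq_2)
    qed
    moreover have "hops N CCW p (receiver_pos N B2 p) = N div 2"
      using hops_receiver_B2[OF p(2)] assms(1-5) by simp
    \<comment> \<open>Equivalent to \<open>d \<le> n\<close>. The share travels
      \<open>N div 2\<close> hops and the position next to the block is \<open>N - d - 1\<close>
      hops away, so that position is at best the one that holds the share until round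
      \<open>N - 1\<close>.\<close>
    moreover have "N div 2 \<le> N - d"
      using assms(1-6) by linarith
    ultimately show ?thesis
      using CCW assms(6) e(1)
      by (auto simp: Share_due entry_def simp flip: p_def simp del: receiver_pos.simps)
  qed
qed

definition similar :: "(dir \<times> tag) set \<Rightarrow> (dir \<Rightarrow> msg) \<Rightarrow> (dir \<Rightarrow> msg) \<Rightarrow> bool" where
  "similar E m m' \<longleftrightarrow> (\<forall>\<delta> \<tau>. (\<delta>, \<tau>) \<notin> E \<longrightarrow> m \<delta> \<tau> = m' \<delta> \<tau>)"

lemma xor_cancel: "(a XOR b XOR c) XOR c = a XOR b" for a b c :: nat
  by (simp add: xor.assoc)

text \<open>No \<open>Input\<close> is due before round \<open>N\<close>, so the new input shows
  only through the shares of the hidden agent, and the new pad alters just the two in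
  \<open>E\<close>. Forwarded values are copied, so they differ only where the received ones
  did.\<close>

lemma protocol_send_change_input:
  assumes "length h = Suc t" "length h' = Suc t" "t < agents \<omega> + d - 1"
    and "\<And>s. s \<le> t \<Longrightarrow> similar E (h ! s) (h' ! s)" "E = affected (pos (info d \<omega> (hidden \<omega>)))"
    and \<omega>: "b < agents \<omega>" "focal \<omega> < agents \<omega>" "1 \<le> d"
      "length (inputs \<omega>) = agents \<omega>" "length (pads \<omega>) = agents \<omega>"
  shows "similar E (protocol_send (info d \<omega> b) h) (protocol_send (info d (change_input x \<omega>) b) h')"
  unfolding similar_def
proof (intro allI impI)
  fix \<delta> \<tau>
  assume \<tau>: "(\<delta>, \<tau>) \<notin> E"
  define N p where "N = agents \<omega> + d - 1" and "p = pos (info d \<omega> b)"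
  have p: "p < N"
    using pos_info_less \<omega> by (simp add: p_def N_def)
  consider "\<tau> \<notin> due N p \<delta> t" | "\<tau> \<in> due N p \<delta> t" "origin \<tau> = p" | "\<tau> \<in> due N p \<delta> t" "origin \<tau> \<noteq> p"
    by blast
  then show "protocol_send (info d \<omega> b) h \<delta> \<tau> = protocol_send (info d (change_input x \<omega>) b) h' \<delta> \<tau>"
  proof cases
    case 1
    then show ?thesis
      using assms(1,2) by (simp add: protocol_send_def Let_def N_def p_def)
  next
    case 2
    have "own_value (info d \<omega> b) \<delta> \<tau> = own_value (info d (change_input x \<omega>) b) \<delta> \<tau>"
    proof (cases "b = hidden \<omega>")
      case True
      have "\<tau> \<noteq> Input a" for a
        using 2(1) assms(3) by (auto simp: Input_due N_def)
      then obtain k where "\<tau> = Share k p"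
        using 2(2) by (cases \<tau>) auto
      then show ?thesis
        using \<tau> True assms(5) \<omega>
        by (cases \<delta>; cases k) (auto simp: affected_def own_value_def change_input_def p_def xor_cancel)
    qed (simp add: info_change_input)
    then show ?thesis
      using 2 assms(1,2) by (simp add: protocol_send_def Let_def N_def p_def)
  next
    case 3
    then have "arrival N \<tau> (hops N \<delta> (origin \<tau>) p) \<le> t"
      using due_forward(2) p by blast
    then show ?thesis
      using 3 assms(1,2,4) \<tau> by (simp add: protocol_send_def Let_def similar_def N_def p_def)
  qed
qed

text \<open>The bounds differ by one round for a reason. An affected value may reach the focal agent
  in round \<open>N\<close>; but what it sends in round \<open>N - 1\<close> rests on earlier
  receipts, so honest agents still receive similar messages in round \<open>N\<close>, the entry
  that \<open>learnt_input\<close> reads. Each claim needs the other, hence the joint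
  induction.\<close>

lemma hist_change_input:
  fixes \<sigma> \<omega> \<beta> S x
  defines "d \<equiv> dup \<sigma>"
  defines "N \<equiv> agents \<omega> + d - 1"
  defines "E \<equiv> affected (pos (info d \<omega> (hidden \<omega>)))"
  defines "h \<equiv> hist (ring_protocol \<beta> S) \<sigma> \<omega>"
  defines "h' \<equiv> hist (ring_protocol \<beta> S) \<sigma> (change_input x \<omega>)"
  assumes \<omega>: "focal \<omega> < agents \<omega>" "2 \<le> agents \<omega>" "1 \<le> d" "d \<le> agents \<omega>"
    "length (inputs \<omega>) = agents \<omega>" "length (pads \<omega>) = agents \<omega>"
  shows "t < N \<Longrightarrow> h t (focal \<omega>) = h' t (focal \<omega>)"
    and "b < agents \<omega> \<Longrightarrow> b \<noteq> focal \<omega> \<Longrightarrow> t \<le> N \<Longrightarrow> s \<le> t \<Longrightarrow> similar E (h t b ! s) (h' t b ! s)"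
proof -
  define n f where "n = agents \<omega>" and "f = focal \<omega>"
  define sent where "sent t b = send (strategy_of (ring_protocol \<beta> S) \<sigma> \<omega> b) (info d \<omega> b) (h t b)" for t b
  define sent' where "sent' t b = send (strategy_of (ring_protocol \<beta> S) \<sigma> \<omega> b) (info d (change_input x \<omega>) b) (h' t b)" for t b
  have st: "strategy_of \<Lambda> \<sigma> (change_input x \<omega>) = strategy_of \<Lambda> \<sigma> \<omega>" for \<Lambda>
    by (simp add: strategy_of_def fun_eq_iff)
  have h_Suc: "h (Suc t) b = h t b @ [\<lambda>\<delta>. sent t (neighbour n (opp \<delta>) b) \<delta>]" for t b
    by (simp add: h_def sent_def n_def d_def Let_def)
  have h'_Suc: "h' (Suc t) b = h' t b @ [\<lambda>\<delta>. sent' t (neighbour n (opp \<delta>) b) \<delta>]" for t b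
    by (simp add: h'_def sent'_def n_def d_def Let_def st)
  have len: "length (h t b) = Suc t" "length (h' t b) = Suc t" for t b
    by (simp_all add: h_def h'_def)
  have "(t < N \<longrightarrow> h t f = h' t f) \<and>
    (t \<le> N \<longrightarrow> (\<forall>b<n. b \<noteq> f \<longrightarrow> (\<forall>s\<le>t. similar E (h t b ! s) (h' t b ! s))))" for t
  proof (induction t)
    case 0
    then show ?case
      by (simp add: h_def h'_def similar_def)
  next
    case (Suc t)
    have honest: "similar E (sent t b) (sent' t b)" if "b < n" "b \<noteq> f" "t < N" for b
      using that Suc.IH \<omega> protocol_send_change_input[of "h t b" t "h' t b" \<omega> d E b x] len
      by (simp add: sent_def sent'_def strategy_of_def n_def f_def N_def E_def)
    have focal: "sent t f = sent' t f" if "t < N"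
      using that Suc.IH \<omega> info_change_input[of f \<omega> d x] hidden_neq[of \<omega>]
      by (simp add: sent_def sent'_def f_def)
    have "sent t (neighbour n (opp \<delta>) f) \<delta> \<tau> = sent' t (neighbour n (opp \<delta>) f) \<delta> \<tau>"
      if "Suc t < N" for \<delta> \<tau>
    proof (cases "(\<delta>, \<tau>) \<in> E")
      case True
      define c where "c = neighbour n (opp \<delta>) f"
      have c: "c < n" "c \<noteq> f"
        using \<omega> neighbour_less[of f n] neighbour_focal_neq[of \<omega>] by (auto simp: c_def n_def f_def)
      have pc: "pos (info d \<omega> c) = neighbour N (opp \<delta>) (entry d f \<delta>)"
        using pos_neighbour_focal[of \<omega> d \<delta>] \<omega> by (simp add: c_def n_def f_def N_def)
      have "neighbour N CCW f = pos (info d \<omega> (hidden \<omega>))"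
        using pos_neighbour_focal[of \<omega> d CW] \<omega> by (simp add: hidden_def entry_def f_def N_def)
      \<comment> \<open>An affected label is not yet due next to the block, so the honest neighbour
        sends \<open>None\<close> for it in both runs.\<close>
      then have "\<tau> \<notin> due N (pos (info d \<omega> c)) \<delta> t"
        using affected_not_due[of f n d N t \<delta> \<tau>] True that \<omega>
        by (simp add: E_def pc n_def f_def N_def)
      then show ?thesis
        unfolding c_def[symmetric] using c(2) len
        by (simp add: sent_def sent'_def strategy_of_def protocol_send_def Let_def N_def f_def)
    next
      case False
      have "neighbour n (opp \<delta>) f < n" "neighbour n (opp \<delta>) f \<noteq> f"
        using \<omega> neighbour_less[of f n] neighbour_focal_neq[of \<omega>] by (auto simp: n_def f_def)
      then show ?thesis
        using honest that False by (auto simp: similar_def)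
    qed
    then have "h (Suc t) f = h' (Suc t) f" if "Suc t < N"
      using Suc.IH that by (simp add: h_Suc h'_Suc fun_eq_iff)
    moreover have "similar E (h (Suc t) b ! s) (h' (Suc t) b ! s)"
      if "Suc t \<le> N" "b < n" "b \<noteq> f" "s \<le> Suc t" for b s
    proof (cases "s = Suc t")
      case True
      have "similar E (sent t c) (sent' t c)" if "c < n" for c
        using that \<open>Suc t \<le> N\<close> honest[of c] focal by (cases "c = f") (auto simp: similar_def)
      then show ?thesis
        using True \<open>b < n\<close> by (simp add: h_Suc h'_Suc nth_append len similar_def neighbour_less)
    next
      case False
      then show ?thesis
        using that Suc.IH by (simp add: h_Suc h'_Suc nth_append len)
    qed
    ultimately show ?case
      by blast
  qed
  then show "t < N \<Longrightarrow> h t (focal \<omega>) = h' t (focal \<omega>)"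
    "b < agents \<omega> \<Longrightarrow> b \<noteq> focal \<omega> \<Longrightarrow> t \<le> N \<Longrightarrow> s \<le> t \<Longrightarrow> similar E (h t b ! s) (h' t b ! s)"
    by (simp_all add: n_def f_def)
qed

section \<open>Orbits under \<open>change_input\<close>\<close>

definition valid_world :: "nat \<Rightarrow> nat \<Rightarrow> ks \<Rightarrow> world \<Rightarrow> bool" where
  "valid_world \<alpha> \<beta> S \<omega> \<longleftrightarrow> \<alpha> \<le> agents \<omega> \<and> agents \<omega> \<le> \<beta> \<and> focal \<omega> < agents \<omega> \<and>
     length (inputs \<omega>) = agents \<omega> \<and> set (inputs \<omega>) \<subseteq> ks_inputs S \<and>
     length (pads \<omega>) = agents \<omega> \<and> (\<forall>R \<in> set (pads \<omega>). \<forall>k. R k < 2 ^ ks_bits S)"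

lemma xor_less: "a < 2 ^ m \<Longrightarrow> b < 2 ^ m \<Longrightarrow> a XOR b < 2 ^ m" for a b :: nat
  by (simp flip: take_bit_nat_eq_self_iff)

lemma pads_change_input:
  "pads (change_input x \<omega>) = (pads \<omega>)[hidden \<omega> := (pads \<omega> ! hidden \<omega>)
     (B1 := (pads \<omega> ! hidden \<omega>) B1 XOR inputs \<omega> ! hidden \<omega> XOR x)]"
  by (simp add: change_input_def)

lemma xor_left_cancel: "a XOR (a XOR b) = b" for a b :: nat
  by (simp flip: xor.assoc)

lemma valid_change_input:
  assumes "valid_world \<alpha> \<beta> S \<omega>" "x \<in> ks_inputs S" "ks_inputs S \<subseteq> {..<2 ^ ks_bits S}"
  shows "valid_world \<alpha> \<beta> S (change_input x \<omega>)"
proof -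
  have h: "hidden \<omega> < agents \<omega>"
    using assms(1) by (simp add: valid_world_def hidden_less)
  then have "inputs \<omega> ! hidden \<omega> \<in> ks_inputs S" "\<forall>k. (pads \<omega> ! hidden \<omega>) k < 2 ^ ks_bits S"
    using assms(1) by (auto simp: valid_world_def)
  moreover have "x < 2 ^ ks_bits S" "inputs \<omega> ! hidden \<omega> < 2 ^ ks_bits S"
    using calculation assms(2,3) by auto
  ultimately have "set (pads (change_input x \<omega>)) \<subseteq> {R. \<forall>k. R k < 2 ^ ks_bits S}"
    unfolding pads_change_input
    using assms(1) by (intro set_update_subsetI) (auto simp: valid_world_def xor_less)
  moreover have "set (inputs (change_input x \<omega>)) \<subseteq> ks_inputs S"
    unfolding inputs_change_input using assms(1,2) by (intro set_update_subsetI) (simp_all add: valid_world_def)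
  ultimately show ?thesis
    using assms(1) by (auto simp: valid_world_def change_input_def)
qed

text \<open>The intermediate input cancels in the pad, so any member of an orbit generates the whole
  orbit.\<close>

lemma change_input_twice:
  assumes "focal \<omega> < agents \<omega>" "length (inputs \<omega>) = agents \<omega>" "length (pads \<omega>) = agents \<omega>"
  shows "change_input y (change_input x \<omega>) = change_input y \<omega>"
  using hidden_less[of \<omega>] assms
  by (simp add: change_input_def hidden_def xor.assoc xor_left_cancel)

lemma change_input_same:
  assumes "focal \<omega> < agents \<omega>" "length (inputs \<omega>) = agents \<omega>" "length (pads \<omega>) = agents \<omega>"
  shows "change_input (inputs \<omega> ! hidden \<omega>) \<omega> = \<omega>"
  using hidden_less[of \<omega>] assms by (simp add: change_input_def hidden_def)

text \<open>This is where \<open>d \<le> n\<close> enters: every simulated agent has a receiver that is not simulated.\<close>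

lemma honest_receiver:
  assumes "focal \<omega> < agents \<omega>" "2 \<le> agents \<omega>" "1 \<le> d" "d \<le> agents \<omega>"
    and "a \<in> {focal \<omega>..<focal \<omega> + d}"
  obtains k b where "b < agents \<omega>" "b \<noteq> focal \<omega>"
    "receiver_pos (agents \<omega> + d - 1) k a = pos (info d \<omega> b)"
proof -
  define N where "N = agents \<omega> + d - 1"
  \<comment> \<open>The antipodal receiver lies outside the block for all simulated agents but
    possibly the last: for \<open>d = n\<close> it is exactly \<open>d - 1\<close> positions behind
    that agent, which is the first of the block. The last agent has its clockwise neighbour
    instead.\<close>
  define k where "k = (if a = focal \<omega> + d - 1 then B1 else B2)"
  have "a < focal \<omega> + d"
    using assms(5) by simp
  then have "a < N"
    using assms(1) unfolding N_def by linarith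
  then have "receiver_pos N k a < N"
    by (simp add: receiver_pos_less)
  moreover have "receiver_pos N k a \<notin> {focal \<omega>..<focal \<omega> + d}"
  proof (cases "a = focal \<omega> + d - 1")
    case True
    then have "receiver_pos N k a = (if focal \<omega> + d < N then focal \<omega> + d else 0)"
      using receiver_pos_B1[OF \<open>a < N\<close>] assms(3) by (simp add: k_def)
    moreover have "0 < focal \<omega>" if "\<not> focal \<omega> + d < N"
      using that assms(2,3) unfolding N_def by linarith
    ultimately show ?thesis
      by auto
  next
    case False
    have "d - 1 \<le> N div 2" "1 \<le> N div 2" "d \<le> N - N div 2"
      using assms(2-4) unfolding N_def by linarith+
    then have "a - N div 2 < focal \<omega>" if "N div 2 \<le> a"
      using that False assms(5) by auto
    moreover have "focal \<omega> + d \<le> a + N - N div 2"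
      using \<open>d \<le> N - N div 2\<close> assms(5) by auto
    moreover have "receiver_pos N k a = (if N div 2 \<le> a then a - N div 2 else a + N - N div 2)"
      using False \<open>1 \<le> N div 2\<close> receiver_pos_B2[OF \<open>a < N\<close>] by (simp add: k_def del: receiver_pos.simps)
    ultimately show ?thesis
      by auto
  qed
  ultimately show ?thesis
    using honest_position[OF assms(1) _ _ assms(3)] that unfolding N_def by metis
qed

section \<open>The share of an orbit that can be won\<close>

abbreviation wins :: "nat \<Rightarrow> ks \<Rightarrow> strategy \<Rightarrow> nat \<Rightarrow> world \<Rightarrow> real" where
  "wins \<beta> S \<sigma> p \<omega> \<equiv> utility p (focal \<omega>) (outputs (ring_protocol \<beta> S) \<sigma> \<omega>)"

lemma utility_cases: "utility p a os = 0 \<or> utility p a os = 1"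
  by (simp add: utility_def)

lemma utility_le: "(utility p a os \<noteq> 0 \<Longrightarrow> P) \<Longrightarrow> utility p a os \<le> of_bool P"
  by (cases P) (auto simp: utility_def)

text \<open>A simulated input is tied by an honest receiver to shares that agree in both runs, and
  the input of an honest agent is its true one. So a deviation that wins at two members of an orbit
  cannot have adapted its announcements to the hidden input.\<close>

lemma winning_inputs_eq:
  fixes \<sigma> \<omega> \<beta> S x
  defines "d \<equiv> dup \<sigma>" and "\<omega>' \<equiv> change_input x \<omega>"
  defines "N \<equiv> agents \<omega> + d - 1" and "c \<equiv> hidden \<omega>"
  assumes v: "valid_world \<alpha> \<beta> S \<omega>" "2 \<le> agents \<omega>" "1 \<le> d" "d \<le> agents \<omega>"
    and win: "wins \<beta> S \<sigma> p \<omega> \<noteq> 0" "wins \<beta> S \<sigma> p \<omega>' \<noteq> 0"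
    and a: "a < N" "a \<noteq> pos (info d \<omega> c)"
  shows "received_input (info d \<omega> c) (hist (ring_protocol \<beta> S) \<sigma> \<omega> (2 * N) c) a =
    received_input (info d \<omega>' c) (hist (ring_protocol \<beta> S) \<sigma> \<omega>' (2 * N) c) a"
proof -
  have \<omega>: "focal \<omega> < agents \<omega>" "length (inputs \<omega>) = agents \<omega>" "length (pads \<omega>) = agents \<omega>"
    using v by (auto simp: valid_world_def)
  have \<omega>': "agents \<omega>' = agents \<omega>" "focal \<omega>' = focal \<omega>" "pos (info d \<omega>' b) = pos (info d \<omega> b)" for b
    by (simp_all add: \<omega>'_def)
  note w = winning_run[OF \<omega>(1) v(2,3)[unfolded d_def] win(1), folded d_def, folded N_def hidden_def, folded c_def]
  note w' = winning_run[of \<omega>', unfolded \<omega>', OF \<omega>(1) v(2,3)[unfolded d_def] win(2)[unfolded \<omega>'],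
      folded d_def, unfolded \<omega>', folded N_def hidden_def, folded c_def]
  show ?thesis
  proof (cases "a \<in> {focal \<omega>..<focal \<omega> + d}")
    case True
    obtain k b where b: "b < agents \<omega>" "b \<noteq> focal \<omega>" "receiver_pos N k a = pos (info d \<omega> b)"
      using honest_receiver[OF \<omega>(1) v(2-4) True] unfolding N_def by metis
    have "similar (affected (pos (info d \<omega> c))) (hist (ring_protocol \<beta> S) \<sigma> \<omega> N b ! N)
        (hist (ring_protocol \<beta> S) \<sigma> \<omega>' N b ! N)"
      unfolding \<omega>'_def c_def d_def N_def
      using \<omega> v b by (intro hist_change_input(2)) (auto simp: d_def)
    then have "learnt_input N (hist (ring_protocol \<beta> S) \<sigma> \<omega> N b) k a =
        learnt_input N (hist (ring_protocol \<beta> S) \<sigma> \<omega>' N b) k a"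
      using a by (simp add: learnt_input_def similar_def affected_def)
    then show ?thesis
      using w(5)[OF True b] w'(5)[OF True b]
      by (simp add: learnt_input_def hist_nth[of N "2 * N"])
  next
    case False
    obtain b where b: "b < agents \<omega>" "b \<noteq> focal \<omega>" "a = pos (info d \<omega> b)"
      using honest_position[OF \<omega>(1) a(1)[unfolded N_def] False v(3)] by metis
    then have "b \<noteq> c"
      using a by auto
    then show ?thesis
      using w(4)[OF b(1,2)] w'(4)[OF b(1,2)] b(3) by (simp add: \<omega>'_def inputs_change_input c_def)
  qed
qed

text \<open>The k fibres over \<open>ks_range S\<close> partition the inputs and have equal size by
  Full Knowledge. In particular no fibre is empty, which is what lets the cheater find a suitable
  input.\<close>

lemma full_knowledge_card:
  assumes "knowledge_sharing k S" "p \<in> ks_range S" "0 < k" "set xs \<subseteq> ks_inputs S" "j < length xs"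
  shows "k * card {x \<in> ks_inputs S. ks_fun S (xs[j := x]) = p} = card (ks_inputs S)"
proof -
  define C where "C y = {x \<in> ks_inputs S. ks_fun S (xs[j := x]) = y}" for y
  have fin: "finite (ks_inputs S)" "full_knowledge S" "card (ks_range S) = k"
    using assms(1) by (auto simp: knowledge_sharing_def)
  have "ks_fun S (xs[j := x]) \<in> ks_range S" if "x \<in> ks_inputs S" for x
    unfolding ks_range_def
    using assms(4,5) that set_update_subsetI[OF assms(4) that, of j] by (intro imageI) auto
  then have U: "ks_inputs S = (\<Union>y\<in>ks_range S. C y)"
    by (auto simp: C_def)
  have fr: "finite (ks_range S)"
    using fin(3) \<open>0 < k\<close> by (intro card_ge_0_finite) simp
  have eq: "card (C y) = card (C p)" if "y \<in> ks_range S" for y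
    unfolding C_def
    using fin(2)[unfolded full_knowledge_def, rule_format, of xs j y p] assms(2,4,5) that by blast
  have "card (ks_inputs S) = (\<Sum>y\<in>ks_range S. card (C y))"
    unfolding U using fr fin(1) by (intro card_UN_disjoint) (auto simp: C_def)
  also have "\<dots> = (\<Sum>y\<in>ks_range S. card (C p))"
    by (intro sum.cong refl eq)
  finally show ?thesis
    by (simp add: fin(3) C_def)
qed

text \<open>If any member is won, its received vector \<open>xs\<close> serves for all: a win at
  \<open>x\<close> forces \<open>ks_fun S (xs[j := x]) = p\<close>, which Full Knowledge allows for
  one k-th of the inputs.\<close>

lemma sum_orbit_le:
  assumes S: "knowledge_sharing k S" "p \<in> ks_range S" "0 < k"
    and v: "valid_world \<alpha> \<beta> S \<omega>" "2 \<le> agents \<omega>" "1 \<le> dup \<sigma>" "\<beta> \<le> 2 * agents \<omega> - 1"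
  shows "k * (\<Sum>x\<in>ks_inputs S. wins \<beta> S \<sigma> p (change_input x \<omega>)) \<le> card (ks_inputs S)"
proof (cases "\<exists>x\<in>ks_inputs S. wins \<beta> S \<sigma> p (change_input x \<omega>) \<noteq> 0")
  case False
  then have "(\<Sum>x\<in>ks_inputs S. wins \<beta> S \<sigma> p (change_input x \<omega>)) = 0"
    by (intro sum.neutral) blast
  then show ?thesis
    by (simp only: mult_zero_right)
next
  case True
  then obtain y where y: "y \<in> ks_inputs S" "wins \<beta> S \<sigma> p (change_input y \<omega>) \<noteq> 0"
    by blast
  have fin: "finite (ks_inputs S)" "ks_inputs S \<subseteq> {..<2 ^ ks_bits S}"
    using S by (auto simp: knowledge_sharing_def)
  define \<omega>' where "\<omega>' = change_input y \<omega>"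
  define d N c where "d = dup \<sigma>" and "N = agents \<omega> + d - 1" and "c = hidden \<omega>"
  have \<omega>: "focal \<omega> < agents \<omega>" "length (inputs \<omega>) = agents \<omega>" "length (pads \<omega>) = agents \<omega>"
    using v by (auto simp: valid_world_def)
  have v': "valid_world \<alpha> \<beta> S \<omega>'"
    using valid_change_input[OF v(1) y(1) fin(2)] by (simp add: \<omega>'_def)
  have c: "c < agents \<omega>" "c \<noteq> focal \<omega>"
    using \<omega> v by (simp_all add: c_def hidden_less hidden_neq)
  have eqs: "agents \<omega>' = agents \<omega>" "focal \<omega>' = focal \<omega>" "hidden \<omega>' = c"
    "pos (info d \<omega>' b) = pos (info d \<omega> b)" for b
    by (simp_all add: \<omega>'_def c_def)
  define j where "j = pos (info d \<omega> c)"
  define r where "r \<omega> = received_input (info d \<omega> c) (hist (ring_protocol \<beta> S) \<sigma> \<omega> (2 * N) c)" for \<omega>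
  have w: "N \<le> \<beta>" "ks_fun S (map (r \<omega>1) [0..<N]) = p" "\<And>a. a < N \<Longrightarrow> r \<omega>1 a \<in> ks_inputs S"
    "r \<omega>1 j = inputs \<omega>1 ! c"
    if "wins \<beta> S \<sigma> p \<omega>1 \<noteq> 0" "\<omega>1 = change_input x \<omega>" for \<omega>1 x
    using winning_run[of \<omega>1 \<sigma> p \<beta> S] that \<omega>(1) v(2,3) c
    by (simp_all add: r_def d_def N_def j_def c_def flip: hidden_def)
  \<comment> \<open>A win entails acceptance, hence
    \<open>N = n + d - 1 \<le> \<beta> \<le> 2 * n - 1\<close>.\<close>
  have "d \<le> agents \<omega>"
    using w(1)[OF y(2) refl] v by (simp add: N_def)
  define xs where "xs = map (r \<omega>') [0..<N]"
  have xs: "set xs \<subseteq> ks_inputs S" "j < length xs"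
    using w(3)[OF y(2) refl] pos_info_less[of c \<omega> d] c v(3)
    by (auto simp: xs_def \<omega>'_def d_def j_def N_def)
  have "ks_fun S (xs[j := x]) = p" if x: "x \<in> ks_inputs S" "wins \<beta> S \<sigma> p (change_input x \<omega>) \<noteq> 0" for x
  proof -
    have x': "change_input x \<omega> = change_input x \<omega>'"
      using \<omega> by (simp add: \<omega>'_def change_input_twice)
    have "r \<omega>' a = r (change_input x \<omega>) a" if "a < N" "a \<noteq> j" for a
      using winning_inputs_eq[of \<alpha> \<beta> S \<omega>' \<sigma> p x a] v' v(2,3) \<open>d \<le> agents \<omega>\<close> y(2) x(2) that
      unfolding x' by (simp add: eqs r_def d_def N_def j_def) (simp add: \<omega>'_def)
    moreover have "r (change_input x \<omega>) j = x"
      using w(4)[OF x(2) refl] c \<omega> by (simp add: inputs_change_input c_def)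
    ultimately have "xs[j := x] = map (r (change_input x \<omega>)) [0..<N]"
      by (intro nth_equalityI) (use xs(2) in \<open>auto simp: xs_def nth_list_update\<close>)
    then show ?thesis
      using w(2)[OF x(2) refl] by simp
  qed
  then have "(\<Sum>x\<in>ks_inputs S. wins \<beta> S \<sigma> p (change_input x \<omega>)) \<le>
      (\<Sum>x\<in>ks_inputs S. of_bool (ks_fun S (xs[j := x]) = p))"
    by (intro sum_mono utility_le)
  also have "\<dots> = card {x \<in> ks_inputs S. ks_fun S (xs[j := x]) = p}"
    using fin(1) by (simp add: of_bool_def sum.If_cases Int_def)
  finally have "k * (\<Sum>x\<in>ks_inputs S. wins \<beta> S \<sigma> p (change_input x \<omega>)) \<le>
      k * real (card {x \<in> ks_inputs S. ks_fun S (xs[j := x]) = p})"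
    by (intro mult_left_mono) auto
  then show ?thesis
    using full_knowledge_card[OF S xs] by (simp flip: of_nat_mult)
qed

lemma sum_orbit_honest:
  assumes S: "knowledge_sharing k S" "p \<in> ks_range S" "0 < k"
    and v: "valid_world \<alpha> \<beta> S \<omega>" "2 \<le> agents \<omega>"
  shows "k * (\<Sum>x\<in>ks_inputs S. wins \<beta> S (ring_protocol \<beta> S) p (change_input x \<omega>)) = card (ks_inputs S)"
proof -
  have fin: "finite (ks_inputs S)" "ks_inputs S \<subseteq> {..<2 ^ ks_bits S}"
    using S by (auto simp: knowledge_sharing_def)
  have "wins \<beta> S (ring_protocol \<beta> S) p (change_input x \<omega>) =
      of_bool (ks_fun S ((inputs \<omega>)[hidden \<omega> := x]) = p)" if "x \<in> ks_inputs S" for x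
    using valid_change_input[OF v(1) that fin(2)] v(2) honest_utility[of "change_input x \<omega>" \<beta> S p]
    by (simp add: valid_world_def inputs_change_input)
  then have "(\<Sum>x\<in>ks_inputs S. wins \<beta> S (ring_protocol \<beta> S) p (change_input x \<omega>)) =
      card {x \<in> ks_inputs S. ks_fun S ((inputs \<omega>)[hidden \<omega> := x]) = p}"
    using fin(1) by (simp add: of_bool_def sum.If_cases Int_def)
  moreover have "hidden \<omega> < length (inputs \<omega>)" "set (inputs \<omega>) \<subseteq> ks_inputs S"
    using v hidden_less[of \<omega>] by (auto simp: valid_world_def)
  ultimately show ?thesis
    using full_knowledge_card[OF S] by (simp flip: of_nat_mult)
qed

text \<open>From round \<open>N\<close> on the input of the deviating agent is committed.\<close>

lemma late_deviation:
  assumes v: "valid_world \<alpha> \<beta> S \<omega>" "2 \<le> agents \<omega>" and t: "agents \<omega> \<le> t"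
    and \<sigma>: "\<sigma> \<in> deviations (ring_protocol \<beta> S) (Round t)"
  shows "wins \<beta> S \<sigma> p \<omega> \<le> wins \<beta> S (ring_protocol \<beta> S) p \<omega>"
proof (cases "wins \<beta> S \<sigma> p \<omega> = 0")
  case True
  then show ?thesis
    using utility_cases by (metis order_refl zero_le_one)
next
  case False
  define c n where "c = hidden \<omega>" and "n = agents \<omega>"
  define r where "r = received_input (info 1 \<omega> c) (hist (ring_protocol \<beta> S) \<sigma> \<omega> (2 * n) c)"
  have \<omega>: "focal \<omega> < agents \<omega>" "length (inputs \<omega>) = agents \<omega>"
    using v by (auto simp: valid_world_def)
  have d: "dup \<sigma> = 1"
    using \<sigma> by (simp add: deviations_def)
  have w: "ks_fun S (map r [0..<n]) = p"
    "\<And>b. b < n \<Longrightarrow> b \<noteq> focal \<omega> \<Longrightarrow> r b = inputs \<omega> ! b"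
    "\<And>b k. b < n \<Longrightarrow> b \<noteq> focal \<omega> \<Longrightarrow> receiver_pos n k (focal \<omega>) = b \<Longrightarrow>
       r (focal \<omega>) = learnt_input n (hist (ring_protocol \<beta> S) \<sigma> \<omega> (2 * n) b) k (focal \<omega>)"
    using winning_run[OF \<omega>(1) v(2) _ False] by (simp_all add: d r_def c_def hidden_def n_def)
  define b where "b = receiver_pos n B1 (focal \<omega>)"
  have b: "b < n" "b \<noteq> focal \<omega>"
    using \<omega>(1) v(2) receiver_pos_less receiver_pos_neq unfolding b_def n_def by metis+
  \<comment> \<open>Histories of length at most \<open>t\<close> are those of rounds before
    \<open>t\<close>, so everything received up to round \<open>t\<close>, and thus in round
    \<open>n\<close>, was sent by the protocol.\<close>
  have "hist (ring_protocol \<beta> S) \<sigma> \<omega> (2 * n) b ! n = hist (ring_protocol \<beta> S) (ring_protocol \<beta> S) \<omega> n b ! n"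
    using \<sigma> t by (subst hist_nth) (auto simp: n_def deviations_def intro!: arg_cong[where f="\<lambda>h. h ! n" for n] hist_cong[where t=t])
  moreover have "(hist (ring_protocol \<beta> S) (ring_protocol \<beta> S) \<omega> n b ! n) \<delta> (Share B1 (focal \<omega>)) =
      Some (own_value (info 1 \<omega> (focal \<omega>)) \<delta> (Share B1 (focal \<omega>)))" for \<delta>
    using honest_hist[OF \<omega>(1) v(2), of b \<beta> S n] b \<omega>(1) v(2)
      Share_due_receiver[of "focal \<omega>" n B1 b \<delta>]
    by (simp add: on_schedule_def scheduled_def b_def n_def del: receiver_pos.simps)
  ultimately have "r (focal \<omega>) = inputs \<omega> ! focal \<omega>"
    using w(3)[OF b b_def[symmetric]] own_value_xor[of "info 1 \<omega> (focal \<omega>)" B1 "focal \<omega>" CW]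
    by (simp add: learnt_input_def) (simp add: own_value_def)
  then have "map r [0..<n] = inputs \<omega>"
    using w(2) \<omega>(2) by (intro nth_equalityI) (auto simp: n_def)
  then have "ks_fun S (inputs \<omega>) = p"
    using w(1) by simp
  then have "wins \<beta> S (ring_protocol \<beta> S) p \<omega> = 1"
    using honest_utility[of \<omega> \<beta> S p] v by (simp add: valid_world_def)
  then show ?thesis
    using utility_cases by (metis order_refl zero_le_one)
qed

section \<open>A profitable duplication\<close>

definition agent_at :: "nat \<Rightarrow> world \<Rightarrow> nat \<Rightarrow> nat" where
  "agent_at d \<omega> a = (if a \<le> focal \<omega> then a else a - (d - 1))"

lemma agent_at_pos: "1 \<le> d \<Longrightarrow> agent_at d \<omega> (pos (info d \<omega> b)) = b"
  by (auto simp: agent_at_def pos_info)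

lemma agent_at_less:
  "focal \<omega> < agents \<omega> \<Longrightarrow> 1 \<le> d \<Longrightarrow> a < agents \<omega> + d - 1 \<Longrightarrow> agent_at d \<omega> a < agents \<omega>"
  by (auto simp: agent_at_def)

text \<open>The simulated agents use the input \<open>x\<^sub>0\<close> and zero pads, except that the first one announces an
  input which it chooses once all honest inputs have passed through it.\<close>

definition choose_input :: "ks \<Rightarrow> nat \<Rightarrow> nat \<Rightarrow> nat list \<Rightarrow> nat" where
  "choose_input S p f xs = (SOME x. x \<in> ks_inputs S \<and> ks_fun S (xs[f := x]) = p)"

definition cheat_value :: "nat \<Rightarrow> nat \<Rightarrow> nat \<Rightarrow> dir \<Rightarrow> tag \<Rightarrow> nat" where
  "cheat_value x\<^sub>0 f y \<delta> \<tau> = (case \<tau> of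
     Share k a \<Rightarrow> (case \<delta> of CW \<Rightarrow> 0 | CCW \<Rightarrow> x\<^sub>0)
   | Input a \<Rightarrow> if a = f then y else x\<^sub>0)"

definition cheat_send :: "nat \<Rightarrow> ks \<Rightarrow> nat \<Rightarrow> nat \<Rightarrow> local_info \<Rightarrow> history \<Rightarrow> dir \<Rightarrow> msg" where
  "cheat_send d S p x\<^sub>0 i h \<delta> =
     (let N = ring_size i; f = pos i;
          y = choose_input S p f (map (\<lambda>a. if a \<in> {f..<f + d} then x\<^sub>0
            else the ((h ! arrival N (Input a) (hops N CW a f)) CW (Input a))) [0..<N]) in
      (\<lambda>\<tau>. if \<tau> \<notin> due N (entry d f (opp \<delta>)) \<delta> (length h - 1) then None
           else if origin \<tau> \<in> {f..<f + d} then Some (cheat_value x\<^sub>0 f y \<delta> \<tau>)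
           else (h ! arrival N \<tau> (hops N \<delta> (origin \<tau>) (entry d f \<delta>))) \<delta> \<tau>))"

definition cheat :: "nat \<Rightarrow> ks \<Rightarrow> nat \<Rightarrow> nat \<Rightarrow> strategy" where
  "cheat d S p x\<^sub>0 = \<lparr>dup = d, send = cheat_send d S p x\<^sub>0, result = \<lambda>_ _. Some p\<rparr>"

lemma hops_entry:
  assumes "a < N" "f + d \<le> N" "1 \<le> d" "a \<notin> {f..<f + d}"
  shows "hops N \<delta> a (entry d f (opp \<delta>)) = hops N \<delta> a (entry d f \<delta>) + (d - 1)"
  using assms by (cases \<delta>) (auto simp: entry_def ring_simps)

text \<open>A value still short of its receiver at the exit of the block was short of it at the
  entry, \<open>d - 1\<close> hops earlier. So whatever must leave the block is found among what
  entered it, and the simulated agents can share one history.\<close>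

lemma due_entry:
  assumes "\<tau> \<in> due N (entry d f (opp \<delta>)) \<delta> t" "f + d \<le> N" "1 \<le> d" "origin \<tau> \<notin> {f..<f + d}"
  obtains t' where "t' \<le> t" "\<tau> \<in> due N (entry d f \<delta>) \<delta> t'"
proof -
  have o: "origin \<tau> < N"
    using assms(1) by (rule due_origin_less)
  note h = hops_entry[OF o assms(2-4), of \<delta>]
  show ?thesis
  proof (cases \<tau>)
    case (Share k a)
    define D where "D = hops N \<delta> a (receiver_pos N k a)"
    define j where "j = hops N \<delta> a (entry d f \<delta>)"
    have "D < N"
      using o Share by (auto simp: D_def intro!: hops_less receiver_pos_less)
    moreover have "j + (d - 1) < D" "t = (if j + (d - 1) + 1 < D then j + (d - 1) else N - 1)"
      using assms(1) h Share by (simp_all add: Share_due D_def j_def)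
    ultimately have "(if j + 1 < D then j else N - 1) \<le> t" "j < D"
      by (auto split: if_splits)
    moreover have "\<tau> \<in> due N (entry d f \<delta>) \<delta> (if j + 1 < D then j else N - 1)"
      using o \<open>j < D\<close> unfolding Share Share_due D_def j_def by simp
    ultimately show ?thesis
      using that by blast
  next
    case (Input a)
    define j where "j = hops N CW a (entry d f CW)"
    have "\<delta> = CW" "j + (d - 1) + 1 < N" "t = N + 1 + (j + (d - 1))"
      using assms(1) h unfolding Input Input_due j_def by auto
    moreover from this have "\<tau> \<in> due N (entry d f \<delta>) \<delta> (N + 1 + j)"
      using o unfolding Input Input_due j_def by auto
    ultimately show ?thesis
      using that[of "N + 1 + j"] by simp
  qed
qed

lemma cheat_wins:
  assumes S: "knowledge_sharing k S" "p \<in> ks_range S" "0 < k" and x\<^sub>0: "x\<^sub>0 \<in> ks_inputs S"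
    and v: "valid_world \<alpha> \<beta> S \<omega>" "2 \<le> agents \<omega>" "2 * agents \<omega> \<le> \<beta>" "d = agents \<omega> + 1"
  shows "wins \<beta> S (cheat d S p x\<^sub>0) p \<omega> = 1"
proof -
  define n N f where "n = agents \<omega>" and "N = 2 * n" and "f = focal \<omega>"
  define \<sigma> where "\<sigma> = cheat d S p x\<^sub>0"
  \<comment> \<open>The value at position \<open>f\<close> is a placeholder, replaced by
    \<open>y\<close> below.\<close>
  define xs where "xs = map (\<lambda>a. if a \<in> {f..<f + d} then x\<^sub>0 else inputs \<omega> ! agent_at d \<omega> a) [0..<N]"
  define y where "y = choose_input S p f xs"
  define val where "val \<delta> \<tau> = (if origin \<tau> \<in> {f..<f + d} then cheat_value x\<^sub>0 f y \<delta> \<tau>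
    else own_value (info d \<omega> (agent_at d \<omega> (origin \<tau>))) \<delta> \<tau>)" for \<delta> \<tau>
  have dup: "dup \<sigma> = d"
    by (simp add: \<sigma>_def cheat_def)
  have \<omega>: "f < n" "2 \<le> n" "length (inputs \<omega>) = n" "set (inputs \<omega>) \<subseteq> ks_inputs S"
    using v by (auto simp: valid_world_def n_def f_def)
  have d: "d = n + 1" "1 \<le> d" "N = agents \<omega> + d - 1" "f + d \<le> N"
    using v(4) \<omega>(1) by (simp_all add: n_def N_def)
  have inp: "inputs \<omega> ! agent_at d \<omega> a \<in> ks_inputs S" if "a < N" for a
    using agent_at_less[of \<omega> d a] \<omega> that d by (simp add: n_def f_def subset_iff)
  have xs: "set xs \<subseteq> ks_inputs S" "f < length xs"
    using inp x\<^sub>0 \<omega>(1) by (auto simp: xs_def N_def)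
  have "card (ks_inputs S) > 0"
    using x\<^sub>0 S(1) by (auto simp: knowledge_sharing_def card_gt_0_iff)
  then have "{x \<in> ks_inputs S. ks_fun S (xs[f := x]) = p} \<noteq> {}"
    using full_knowledge_card[OF S xs] by (metis card.empty less_irrefl mult_0_right)
  then have y: "y \<in> ks_inputs S" "ks_fun S (xs[f := y]) = p"
    using someI_ex[of "\<lambda>x. x \<in> ks_inputs S \<and> ks_fun S (xs[f := x]) = p"]
    unfolding y_def choose_input_def by auto
  have own: "val \<delta> \<tau> = own_value (info d \<omega> b) \<delta> \<tau>"
    if "b \<noteq> focal \<omega>" "origin \<tau> = pos (info d \<omega> b)" for b \<delta> \<tau>
    using pos_info_honest[OF that(1) d(2)] that(2) agent_at_pos[OF d(2), of \<omega> b]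
    by (auto simp: val_def f_def)
  have pf: "pos (info d \<omega> f) = f"
    by (simp add: pos_info f_def)
  have rs: "ring_size (info d \<omega> b) = N" for b
    using d(3) by simp
  have cheating: "cheat_send d S p x\<^sub>0 (info d \<omega> f) h \<delta> = scheduled N val (entry d f (opp \<delta>)) \<delta> t"
    if h: "on_schedule N val (entry d f) h" "length h = Suc t" for h t \<delta>
  proof (rule ext)
    fix \<tau>
    define xs' where "xs' = map (\<lambda>a. if a \<in> {f..<f + d} then x\<^sub>0
            else the ((h ! arrival N (Input a) (hops N CW a f)) CW (Input a))) [0..<N]"
    have send: "cheat_send d S p x\<^sub>0 (info d \<omega> f) h \<delta> \<tau> =
      (if \<tau> \<notin> due N (entry d f (opp \<delta>)) \<delta> t then None
       else if origin \<tau> \<in> {f..<f + d} then Some (cheat_value x\<^sub>0 f (choose_input S p f xs') \<delta> \<tau>)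
       else (h ! arrival N \<tau> (hops N \<delta> (origin \<tau>) (entry d f \<delta>))) \<delta> \<tau>)"
      using h(2) by (simp add: cheat_send_def Let_def pf rs xs'_def del: ring_size_info)
    consider "\<tau> \<notin> due N (entry d f (opp \<delta>)) \<delta> t"
      | "\<tau> \<in> due N (entry d f (opp \<delta>)) \<delta> t" "origin \<tau> \<notin> {f..<f + d}"
      | "\<tau> \<in> due N (entry d f (opp \<delta>)) \<delta> t" "origin \<tau> \<in> {f..<f + d}" "\<tau> \<noteq> Input f"
      | "\<tau> \<in> due N (entry d f (opp \<delta>)) \<delta> t" "\<tau> = Input f"
      by blast
    then show "cheat_send d S p x\<^sub>0 (info d \<omega> f) h \<delta> \<tau> = scheduled N val (entry d f (opp \<delta>)) \<delta> t \<tau>"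
    proof cases
      case 1
      then show ?thesis
        by (simp add: send scheduled_def)
    next
      case 2
      obtain t' where t': "t' \<le> t" "\<tau> \<in> due N (entry d f \<delta>) \<delta> t'"
        using due_entry[OF 2(1) d(4,2) 2(2)] by metis
      have "origin \<tau> \<noteq> entry d f \<delta>" "entry d f \<delta> < N"
        using 2(2) d(2,4) by (auto simp: entry_def split: dir.splits)
      then show ?thesis
        using 2 on_schedule_arrival[OF h t'(2,1)] by (auto simp: send scheduled_def)
    next
      case 3
      then show ?thesis
        unfolding send by (cases \<tau>) (auto simp: scheduled_def val_def cheat_value_def)
    next
      case 4
      have "hops N CW f (f + d - 1) = d - 1"
        using d \<omega>(1) by (simp add: hops_CW)
      \<comment> \<open>The simulated agents delay the first input: it starts in round
        \<open>N + 1\<close> and leaves the block \<open>d - 1\<close> hops later. Every honest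
        input is fewer than \<open>d\<close> hops from \<open>f\<close>, so it has arrived by round
        \<open>N + d\<close>.\<close>
      then have t: "t = N + d" and "\<delta> = CW"
        using 4 d(2) by (auto simp: Input_due entry_def)
      have "(h ! arrival N (Input a) (hops N CW a f)) CW (Input a) = Some (inputs \<omega> ! agent_at d \<omega> a)"
        if a: "a < N" "a \<notin> {f..<f + d}" for a
      proof -
        have "f < N" "a \<noteq> f"
          using a d by auto
        then have "Input a \<in> due N (neighbour N CCW f) CW (N + hops N CW a f)"
          using a(1) by (intro Input_due_receive) auto
        moreover have "hops N CW a f < d"
          using a \<omega>(1) \<open>f < N\<close> d(1) by (auto simp: hops_CW N_def)
        moreover from this have "(h ! Suc (N + hops N CW a f)) CW = scheduled N val (neighbour N CCW f) CW (N + hops N CW a f)"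
          using h(1)[unfolded on_schedule_def, rule_format, of "Suc (N + hops N CW a f)" CW] h(2) t
          by (simp add: entry_def)
        ultimately show ?thesis
          using a by (auto simp: scheduled_def arrival_def val_def own_value_def)
      qed
      then have "xs' = xs"
        unfolding xs'_def xs_def by (intro map_cong) auto
      then show ?thesis
        unfolding send using 4 d(2) by (simp add: scheduled_def val_def y_def)
    qed
  qed
  have sched: "on_schedule N val (entry (width d \<omega> b) (pos (info d \<omega> b))) (hist (ring_protocol \<beta> S) \<sigma> \<omega> t b)"
    if "b < agents \<omega>" for t b
  proof (rule on_schedule_hist[where \<sigma>=\<sigma>, unfolded dup])
    fix b h t \<delta>
    assume b: "b < agents \<omega>" and h: "length h = Suc t"
      "on_schedule N val (entry (width d \<omega> b) (pos (info d \<omega> b))) h"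
    show "send (strategy_of (ring_protocol \<beta> S) \<sigma> \<omega> b) (info d \<omega> b) h \<delta> =
        scheduled N val (entry (width d \<omega> b) (pos (info d \<omega> b)) (opp \<delta>)) \<delta> t"
    proof (cases "b = f")
      case True
      then show ?thesis
        using cheating[of h t \<delta>] h pf by (simp add: strategy_of_def f_def width_def \<sigma>_def cheat_def)
    next
      case False
      then show ?thesis
        using h b d own pos_info_less[OF b d(2)]
        by (auto simp: strategy_of_def f_def width_def intro!: protocol_send_on_schedule)
    qed
  qed (use \<omega> d that in \<open>auto simp: n_def f_def\<close>)
  have "protocol_result \<beta> S (info d \<omega> b) (hist (ring_protocol \<beta> S) \<sigma> \<omega> (2 * N) b) = Some p"
    if b: "b < agents \<omega>" "b \<noteq> focal \<omega>" for b
  proof -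
    define P where "P = pos (info d \<omega> b)"
    have P: "P < N" "P \<notin> {f..<f + d}"
      using pos_info_less[OF b(1) d(2)] pos_info_honest[OF b(2) d(2)] d(3) by (simp_all add: P_def f_def)
    have shares: "val CW (Share k a) XOR val CCW (Share k a) = val CW (Input a)"
      if a: "a < N" "receiver_pos N k a = P" for k a
    proof (cases "a \<in> {f..<f + d}")
      case True
      \<comment> \<open>With \<open>N = 2 * n\<close> the antipode of \<open>f\<close> is
        \<open>f + n\<close>, the last position of the block since \<open>d = n + 1\<close>. Hence
        no honest agent compares the shares of \<open>f\<close> with the announced
        \<open>y\<close>.\<close>
      have "receiver_pos N B1 f = f + 1" "receiver_pos N B2 f = f + n"
        using \<omega> by (auto simp: receiver_pos_B1 receiver_pos_B2 N_def simp del: receiver_pos.simps)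
      then have "receiver_pos N k f \<in> {f..<f + d}"
        using d(1) \<omega>(2) by (cases k) (auto simp del: receiver_pos.simps)
      then have "a \<noteq> f"
        using a P by auto
      then show ?thesis
        using True by (simp add: val_def cheat_value_def)
    next
      case False
      then show ?thesis
        by (auto simp: val_def own_value_xor[where \<delta>=CW])
    qed
    have vals: "map (\<lambda>a. val CW (Input a)) [0..<N] = xs[f := y]"
      using d(2) by (intro nth_equalityI) (auto simp: xs_def val_def cheat_value_def own_value_def nth_list_update)
    have "val CW (Input a) \<in> ks_inputs S" if "a < N" for a
      using inp[OF that] y x\<^sub>0 by (simp add: val_def cheat_value_def own_value_def)
    moreover have "on_schedule N val (\<lambda>_. P) (hist (ring_protocol \<beta> S) \<sigma> \<omega> (2 * N) b)"
      using sched[OF b(1), of "2 * N"] b(2) by (simp add: width_def P_def)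
    moreover have "input (info d \<omega> b) = val CW (Input P)"
      using own[OF b(2), of "Input P" CW] by (simp add: P_def own_value_def)
    moreover have "2 \<le> N" "N \<le> \<beta>"
      using \<omega>(2) v(3) by (simp_all add: N_def n_def)
    ultimately have "protocol_result \<beta> S (info d \<omega> b) (hist (ring_protocol \<beta> S) \<sigma> \<omega> (2 * N) b) =
        Some (ks_fun S (map (\<lambda>a. val CW (Input a)) [0..<N]))"
      using P(1) shares by (intro protocol_result_on_schedule[where p=P] rs length_hist) (simp_all only: P_def)
    then show ?thesis
      by (simp only: vals y(2))
  qed
  then have "outputs (ring_protocol \<beta> S) \<sigma> \<omega> = map (\<lambda>b. Some p) [0..<agents \<omega>]"
    using d(3) by (auto simp: outputs_def strategy_of_def dup) (auto simp: \<sigma>_def cheat_def)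
  then show ?thesis
    using \<omega>(1) by (auto simp: utility_def legal_def \<sigma>_def n_def f_def)
qed

section \<open>Expected utilities\<close>

lemma lists_of_length_nonempty: "x \<in> A \<Longrightarrow> {xs. set xs \<subseteq> A \<and> length xs = n} \<noteq> {}"
  by (auto intro!: exI[of _ "replicate n x"])

lemma finite_pads: "finite {R :: receiver \<Rightarrow> nat. \<forall>k. R k < m}"
proof -
  have "(UNIV :: receiver set) = {B1, B2}"
    using receiver.exhaust by blast
  then have "finite (UNIV :: receiver set)"
    by (metis finite.emptyI finite_insert)
  then have "finite (Pi\<^sub>E (UNIV :: receiver set) (\<lambda>_. {..<m}))"
    by (intro finite_PiE) auto
  then show ?thesis
    by (rule finite_subset[rotated]) auto
qed

text \<open>A world records every draw, so at each draw only one outcome can lead to it and the bind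
  becomes a product.\<close>

lemma pmf_bind_unique:
  assumes "\<And>y. y \<in> set_pmf M \<Longrightarrow> z \<in> set_pmf (F y) \<Longrightarrow> y = x"
  shows "pmf (bind_pmf M F) z = pmf M x * pmf (F x) z"
proof -
  have "pmf (bind_pmf M F) z = (\<integral>y. pmf (F y) z \<partial>measure_pmf M)"
    by (rule pmf_bind)
  also have "\<dots> = (\<Sum>y\<in>{x}. pmf (F y) z * pmf M y)"
    using assms by (intro integral_measure_pmf_real) (auto simp: set_pmf_iff)
  finally show ?thesis
    by simp
qed

abbreviation input_lists :: "ks \<Rightarrow> nat \<Rightarrow> nat list set" where
  "input_lists S n \<equiv> {xs. set xs \<subseteq> ks_inputs S \<and> length xs = n}"

abbreviation pad_lists :: "ks \<Rightarrow> nat \<Rightarrow> (receiver \<Rightarrow> nat) list set" where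
  "pad_lists S n \<equiv> {Rs. set Rs \<subseteq> {R. \<forall>k. R k < 2 ^ ks_bits S} \<and> length Rs = n}"

lemma input_lists:
  assumes "knowledge_sharing k S"
  shows "finite (input_lists S n)" "input_lists S n \<noteq> {}"
  using assms lists_of_length_nonempty[of _ "ks_inputs S"]
  by (auto simp only: knowledge_sharing_def intro!: finite_lists_length_eq)

lemma pad_lists: "finite (pad_lists S n)" "pad_lists S n \<noteq> {}"
  using lists_of_length_nonempty[of "\<lambda>_. 0" "{R :: receiver \<Rightarrow> nat. \<forall>k. R k < 2 ^ ks_bits S}" n]
  by (auto simp only: intro!: finite_lists_length_eq finite_pads) simp

lemma set_geometric_prior: "\<alpha> \<le> \<beta> \<Longrightarrow> set_pmf (geometric_prior \<alpha> \<beta>) \<subseteq> {\<alpha>..\<beta>}"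
  by (auto simp: set_pmf_iff pmf_geometric_prior split: if_splits)

lemma worlds_valid:
  assumes "knowledge_sharing k S" "1 \<le> \<alpha>" "\<alpha> \<le> \<beta>" "\<omega> \<in> set_pmf (worlds \<alpha> \<beta> S)"
  shows "valid_world \<alpha> \<beta> S \<omega>"
proof -
  obtain n f xs Rs where \<omega>: "n \<in> set_pmf (geometric_prior \<alpha> \<beta>)" "f \<in> set_pmf (pmf_of_set {..<n})"
    "xs \<in> set_pmf (pmf_of_set (input_lists S n))" "Rs \<in> set_pmf (pmf_of_set (pad_lists S n))"
    "\<omega> = \<lparr>agents = n, focal = f, inputs = xs, pads = Rs\<rparr>"
    using assms(4) by (auto simp: worlds_def)
  have "n \<in> {\<alpha>..\<beta>}"
    using \<omega>(1) set_geometric_prior[OF assms(3)] by blast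
  moreover from this have "{..<n} \<noteq> {}"
    using assms(2) by (auto simp: lessThan_empty_iff)
  ultimately show ?thesis
    using \<omega>(2-5) input_lists[OF assms(1), of n] pad_lists[of S n] by (auto simp: valid_world_def)
qed

lemma finite_worlds:
  assumes "knowledge_sharing k S" "1 \<le> \<alpha>" "\<alpha> \<le> \<beta>"
  shows "finite (set_pmf (worlds \<alpha> \<beta> S))"
proof (rule finite_subset)
  show "set_pmf (worlds \<alpha> \<beta> S) \<subseteq> (\<Union>n\<in>{\<alpha>..\<beta>}. \<Union>f\<in>{..<n}. \<Union>xs\<in>input_lists S n. \<Union>Rs\<in>pad_lists S n.
      {\<lparr>agents = n, focal = f, inputs = xs, pads = Rs\<rparr>})"
  proof
    fix \<omega>
    assume "\<omega> \<in> set_pmf (worlds \<alpha> \<beta> S)"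
    then show "\<omega> \<in> (\<Union>n\<in>{\<alpha>..\<beta>}. \<Union>f\<in>{..<n}. \<Union>xs\<in>input_lists S n. \<Union>Rs\<in>pad_lists S n.
      {\<lparr>agents = n, focal = f, inputs = xs, pads = Rs\<rparr>})"
      using worlds_valid[OF assms] by (cases \<omega>) (fastforce simp: valid_world_def)
  qed
  show "finite (\<Union>n\<in>{\<alpha>..\<beta>}. \<Union>f\<in>{..<n}. \<Union>xs\<in>input_lists S n. \<Union>Rs\<in>pad_lists S n.
      {\<lparr>agents = n, focal = f, inputs = xs, pads = Rs\<rparr>})"
    using input_lists[OF assms(1)] pad_lists[of S] by (intro finite_UN_I) auto
qed

text \<open>The value depends on the world only through \<open>agents\<close>, which
  \<open>change_input\<close> preserves.\<close>

lemma pmf_worlds: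
  assumes "knowledge_sharing k S" "valid_world \<alpha> \<beta> S \<omega>"
  shows "pmf (worlds \<alpha> \<beta> S) \<omega> = pmf (geometric_prior \<alpha> \<beta>) (agents \<omega>) *
    (1 / agents \<omega> * (1 / card (input_lists S (agents \<omega>)) * (1 / card (pad_lists S (agents \<omega>)))))"
proof -
  define F4 where "F4 n f xs Rs = return_pmf \<lparr>agents = n, focal = f, inputs = xs, pads = Rs\<rparr>" for n f xs Rs
  define F3 where "F3 n f xs = pmf_of_set (pad_lists S n) \<bind> F4 n f xs" for n f xs
  define F2 where "F2 n f = pmf_of_set (input_lists S n) \<bind> F3 n f" for n f
  define F1 where "F1 n = pmf_of_set {..<n} \<bind> F2 n" for n
  have s4: "\<omega> \<in> set_pmf (F4 n f xs Rs) \<Longrightarrow>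
      agents \<omega> = n \<and> focal \<omega> = f \<and> inputs \<omega> = xs \<and> pads \<omega> = Rs" for n f xs Rs
    by (simp add: F4_def)
  have s3: "\<omega> \<in> set_pmf (F3 n f xs) \<Longrightarrow> agents \<omega> = n \<and> focal \<omega> = f \<and> inputs \<omega> = xs" for n f xs
    using s4 by (auto simp: F3_def)
  have s2: "\<omega> \<in> set_pmf (F2 n f) \<Longrightarrow> agents \<omega> = n \<and> focal \<omega> = f" for n f
    using s3 by (auto simp: F2_def)
  have s1: "\<omega> \<in> set_pmf (F1 n) \<Longrightarrow> agents \<omega> = n" for n
    using s2 by (auto simp: F1_def)
  have "pmf (worlds \<alpha> \<beta> S) \<omega> = pmf (geometric_prior \<alpha> \<beta> \<bind> F1) \<omega>"
    by (simp add: worlds_def F1_def[abs_def] F2_def[abs_def] F3_def[abs_def] F4_def[abs_def])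
  also have "\<dots> = pmf (geometric_prior \<alpha> \<beta>) (agents \<omega>) * pmf (F1 (agents \<omega>)) \<omega>"
    using s1 by (intro pmf_bind_unique) blast
  also have "pmf (F1 (agents \<omega>)) \<omega> = pmf (pmf_of_set {..<agents \<omega>}) (focal \<omega>) * pmf (F2 (agents \<omega>) (focal \<omega>)) \<omega>"
    unfolding F1_def using s2 by (intro pmf_bind_unique) blast
  also have "pmf (F2 (agents \<omega>) (focal \<omega>)) \<omega> =
      pmf (pmf_of_set (input_lists S (agents \<omega>))) (inputs \<omega>) * pmf (F3 (agents \<omega>) (focal \<omega>) (inputs \<omega>)) \<omega>"
    unfolding F2_def using s3 by (intro pmf_bind_unique) blast
  also have "pmf (F3 (agents \<omega>) (focal \<omega>) (inputs \<omega>)) \<omega> = pmf (pmf_of_set (pad_lists S (agents \<omega>))) (pads \<omega>) *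
      pmf (F4 (agents \<omega>) (focal \<omega>) (inputs \<omega>) (pads \<omega>)) \<omega>"
    unfolding F3_def using s4 by (intro pmf_bind_unique) blast
  also have "pmf (F4 (agents \<omega>) (focal \<omega>) (inputs \<omega>) (pads \<omega>)) \<omega> = 1"
    by (simp add: F4_def)
  also have "pmf (pmf_of_set {..<agents \<omega>}) (focal \<omega>) = 1 / agents \<omega>"
    using assms(2) by (subst pmf_of_set) (auto simp: valid_world_def)
  also have "pmf (pmf_of_set (input_lists S (agents \<omega>))) (inputs \<omega>) = 1 / card (input_lists S (agents \<omega>))"
    using assms(2) input_lists[OF assms(1), of "agents \<omega>"] by (simp add: valid_world_def)
  also have "pmf (pmf_of_set (pad_lists S (agents \<omega>))) (pads \<omega>) = 1 / card (pad_lists S (agents \<omega>))"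
  proof -
    have "pads \<omega> \<in> pad_lists S (agents \<omega>)"
      using assms(2) by (auto simp: valid_world_def)
    then show ?thesis
      by (simp only: pmf_of_set[OF pad_lists(2,1)] indicator_simps)
  qed
  finally show ?thesis
    by simp
qed

lemma pmf_change_input:
  assumes S: "knowledge_sharing k S" "1 \<le> \<alpha>" "\<alpha> \<le> \<beta>" and \<omega>: "\<omega> \<in> set_pmf (worlds \<alpha> \<beta> S)" "x \<in> ks_inputs S"
  shows "pmf (worlds \<alpha> \<beta> S) (change_input x \<omega>) = pmf (worlds \<alpha> \<beta> S) \<omega>"
  using pmf_worlds[OF S(1)] worlds_valid[OF S \<omega>(1)] valid_change_input[OF worlds_valid[OF S \<omega>(1)] \<omega>(2)] S(1)
  by (simp add: knowledge_sharing_def)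

text \<open>\<open>(\<omega>, x) \<mapsto> (change_input x \<omega>, old input)\<close> is a measure-preserving involution.\<close>

lemma sum_orbits:
  fixes U :: "world \<Rightarrow> real"
  assumes S: "knowledge_sharing k S" "1 \<le> \<alpha>" "\<alpha> \<le> \<beta>" and V: "V \<subseteq> set_pmf (worlds \<alpha> \<beta> S)"
    and closed: "\<And>\<omega> x. \<omega> \<in> V \<Longrightarrow> x \<in> ks_inputs S \<Longrightarrow> change_input x \<omega> \<in> V"
  shows "(\<Sum>\<omega>\<in>V. pmf (worlds \<alpha> \<beta> S) \<omega> * (\<Sum>x\<in>ks_inputs S. U (change_input x \<omega>))) =
    card (ks_inputs S) * (\<Sum>\<omega>\<in>V. pmf (worlds \<alpha> \<beta> S) \<omega> * U \<omega>)"
proof -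
  define g where "g = (\<lambda>(\<omega>, x). (change_input x \<omega>, inputs \<omega> ! hidden \<omega>))"
  have valid: "focal \<omega> < agents \<omega>" "length (inputs \<omega>) = agents \<omega>" "length (pads \<omega>) = agents \<omega>"
      "inputs \<omega> ! hidden \<omega> \<in> ks_inputs S" "hidden \<omega> < agents \<omega>" if "\<omega> \<in> V" for \<omega>
    using worlds_valid[OF S] that V hidden_less[of \<omega>] by (auto simp: valid_world_def subset_iff)
  have g: "g z \<in> V \<times> ks_inputs S" "g (g z) = z" if "z \<in> V \<times> ks_inputs S" for z
    using that valid closed
    by (auto simp: g_def change_input_twice change_input_same inputs_change_input)
  have "(\<Sum>\<omega>\<in>V. pmf (worlds \<alpha> \<beta> S) \<omega> * (\<Sum>x\<in>ks_inputs S. U (change_input x \<omega>))) =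
      (\<Sum>(\<omega>, x)\<in>V \<times> ks_inputs S. pmf (worlds \<alpha> \<beta> S) \<omega> * U (change_input x \<omega>))"
    by (simp add: sum_distrib_left sum.cartesian_product)
  also have "\<dots> = (\<Sum>(\<omega>, x)\<in>V \<times> ks_inputs S. pmf (worlds \<alpha> \<beta> S) \<omega> * U \<omega>)"
  proof (rule sum.reindex_bij_witness[where i=g and j=g])
    fix z
    assume z: "z \<in> V \<times> ks_inputs S"
    then show "(case g z of (\<omega>, x) \<Rightarrow> pmf (worlds \<alpha> \<beta> S) \<omega> * U \<omega>) =
        (case z of (\<omega>, x) \<Rightarrow> pmf (worlds \<alpha> \<beta> S) \<omega> * U (change_input x \<omega>))"
      using pmf_change_input[OF S] V by (auto simp: g_def subset_iff)
  qed (use g in auto)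
  also have "\<dots> = card (ks_inputs S) * (\<Sum>\<omega>\<in>V. pmf (worlds \<alpha> \<beta> S) \<omega> * U \<omega>)"
    by (simp add: sum_distrib_left flip: sum.cartesian_product)
  finally show ?thesis .
qed

lemma change_input_worlds:
  assumes "knowledge_sharing k S" "1 \<le> \<alpha>" "\<alpha> \<le> \<beta>" "\<omega> \<in> set_pmf (worlds \<alpha> \<beta> S)" "x \<in> ks_inputs S"
  shows "change_input x \<omega> \<in> set_pmf (worlds \<alpha> \<beta> S)"
  using pmf_change_input[OF assms] assms(4) by (simp add: set_pmf_iff)

text \<open>Exactly one k-th of every orbit is won. This is applied to the worlds sharing a view
  and, for the converse, to all worlds at once.\<close>

lemma sum_honest:
  assumes S: "knowledge_sharing k S" "2 \<le> \<alpha>" "\<alpha> \<le> \<beta>" and p: "p \<in> ks_range S" "0 < k"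
    and V: "V \<subseteq> set_pmf (worlds \<alpha> \<beta> S)"
    and closed: "\<And>\<omega> x. \<omega> \<in> V \<Longrightarrow> x \<in> ks_inputs S \<Longrightarrow> change_input x \<omega> \<in> V"
  shows "k * (\<Sum>\<omega>\<in>V. pmf (worlds \<alpha> \<beta> S) \<omega> * wins \<beta> S (ring_protocol \<beta> S) p \<omega>) =
    (\<Sum>\<omega>\<in>V. pmf (worlds \<alpha> \<beta> S) \<omega>)"
proof -
  define m where "m = card (ks_inputs S)"
  have m: "m > 0"
    using S(1) by (auto simp: m_def knowledge_sharing_def card_gt_0_iff)
  have \<alpha>: "1 \<le> \<alpha>"
    using S(2) by simp
  have "m * (k * (\<Sum>\<omega>\<in>V. pmf (worlds \<alpha> \<beta> S) \<omega> * wins \<beta> S (ring_protocol \<beta> S) p \<omega>)) =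
      k * (m * (\<Sum>\<omega>\<in>V. pmf (worlds \<alpha> \<beta> S) \<omega> * wins \<beta> S (ring_protocol \<beta> S) p \<omega>))"
    by simp
  also have "\<dots> = k * (\<Sum>\<omega>\<in>V. pmf (worlds \<alpha> \<beta> S) \<omega> *
      (\<Sum>x\<in>ks_inputs S. wins \<beta> S (ring_protocol \<beta> S) p (change_input x \<omega>)))"
    unfolding m_def by (subst sum_orbits[OF S(1) \<alpha> S(3) V closed]) auto
  also have "\<dots> = (\<Sum>\<omega>\<in>V. pmf (worlds \<alpha> \<beta> S) \<omega> *
      (k * (\<Sum>x\<in>ks_inputs S. wins \<beta> S (ring_protocol \<beta> S) p (change_input x \<omega>))))"
    by (simp add: sum_distrib_left mult_ac)
  also have "\<dots> = (\<Sum>\<omega>\<in>V. pmf (worlds \<alpha> \<beta> S) \<omega> * m)"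
  proof (intro sum.cong refl arg_cong2[where f="(*)"])
    fix \<omega>
    assume "\<omega> \<in> V"
    then have "valid_world \<alpha> \<beta> S \<omega>"
      using V worlds_valid[OF S(1) \<alpha> S(3)] by blast
    moreover from this have "2 \<le> agents \<omega>"
      using S(2) by (simp add: valid_world_def)
    ultimately show "k * (\<Sum>x\<in>ks_inputs S. wins \<beta> S (ring_protocol \<beta> S) p (change_input x \<omega>)) = m"
      using sum_orbit_honest[OF S(1) p] by (simp add: m_def)
  qed
  finally show ?thesis
    using m by (simp flip: sum_distrib_right)
qed

lemma sum_deviation_le:
  assumes S: "knowledge_sharing k S" "2 \<le> \<alpha>" "\<alpha> \<le> \<beta>" and p: "p \<in> ks_range S" "0 < k"
    and V: "V \<subseteq> set_pmf (worlds \<alpha> \<beta> S)"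
    and closed: "\<And>\<omega> x. \<omega> \<in> V \<Longrightarrow> x \<in> ks_inputs S \<Longrightarrow> change_input x \<omega> \<in> V"
    and \<sigma>: "1 \<le> dup \<sigma>" and \<beta>: "\<beta> \<le> 2 * \<alpha> - 1"
  shows "(\<Sum>\<omega>\<in>V. pmf (worlds \<alpha> \<beta> S) \<omega> * wins \<beta> S \<sigma> p \<omega>) \<le>
    (\<Sum>\<omega>\<in>V. pmf (worlds \<alpha> \<beta> S) \<omega> * wins \<beta> S (ring_protocol \<beta> S) p \<omega>)"
proof -
  define m where "m = card (ks_inputs S)"
  have m: "m > 0"
    using S(1) by (auto simp: m_def knowledge_sharing_def card_gt_0_iff)
  have \<alpha>: "1 \<le> \<alpha>"
    using S(2) by simp
  have "m * (k * (\<Sum>\<omega>\<in>V. pmf (worlds \<alpha> \<beta> S) \<omega> * wins \<beta> S \<sigma> p \<omega>)) =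
      k * (m * (\<Sum>\<omega>\<in>V. pmf (worlds \<alpha> \<beta> S) \<omega> * wins \<beta> S \<sigma> p \<omega>))"
    by simp
  also have "\<dots> = k * (\<Sum>\<omega>\<in>V. pmf (worlds \<alpha> \<beta> S) \<omega> * (\<Sum>x\<in>ks_inputs S. wins \<beta> S \<sigma> p (change_input x \<omega>)))"
    unfolding m_def by (subst sum_orbits[OF S(1) \<alpha> S(3) V closed]) auto
  also have "\<dots> = (\<Sum>\<omega>\<in>V. pmf (worlds \<alpha> \<beta> S) \<omega> * (k * (\<Sum>x\<in>ks_inputs S. wins \<beta> S \<sigma> p (change_input x \<omega>))))"
    by (simp add: sum_distrib_left mult_ac)
  also have "\<dots> \<le> (\<Sum>\<omega>\<in>V. pmf (worlds \<alpha> \<beta> S) \<omega> * m)"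
  proof (intro sum_mono mult_left_mono)
    fix \<omega>
    assume "\<omega> \<in> V"
    then have "valid_world \<alpha> \<beta> S \<omega>"
      using V worlds_valid[OF S(1) \<alpha> S(3)] by blast
    moreover from this have "2 \<le> agents \<omega>" "\<beta> \<le> 2 * agents \<omega> - 1"
      using S(2) \<beta> by (auto simp: valid_world_def)
    ultimately show "k * (\<Sum>x\<in>ks_inputs S. wins \<beta> S \<sigma> p (change_input x \<omega>)) \<le> m"
      using sum_orbit_le[OF S(1) p _ _ \<sigma>] by (simp add: m_def)
  qed simp
  also have "\<dots> = m * (k * (\<Sum>\<omega>\<in>V. pmf (worlds \<alpha> \<beta> S) \<omega> * wins \<beta> S (ring_protocol \<beta> S) p \<omega>))"
    using sum_honest[OF S p V closed] by (simp flip: sum_distrib_right)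
  finally show ?thesis
    using m p(2) by simp
qed

text \<open>This makes the worlds with a given early view a union of orbits, so the averaging
  survives conditioning on what the focal agent has seen.\<close>

lemma view_change_input:
  assumes "valid_world \<alpha> \<beta> S \<omega>" "2 \<le> agents \<omega>" "s = Wake_Up \<or> s = Round t \<and> t < agents \<omega>"
  shows "view (ring_protocol \<beta> S) s (change_input x \<omega>) = view (ring_protocol \<beta> S) s \<omega>"
proof -
  have \<omega>: "focal \<omega> < agents \<omega>" "length (inputs \<omega>) = agents \<omega>" "length (pads \<omega>) = agents \<omega>"
    "hidden \<omega> \<noteq> focal \<omega>"
    using assms(1,2) by (auto simp: valid_world_def hidden_neq)
  show ?thesis
    using \<omega> assms hist_change_input(1)[of \<omega> "ring_protocol \<beta> S" t \<beta> S x]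
    by (auto simp: view_def inputs_change_input info_change_input)
qed

section \<open>Conditional expectations and the two directions\<close>

lemma expectation_cond_worlds:
  assumes S: "knowledge_sharing k S" "1 \<le> \<alpha>" "\<alpha> \<le> \<beta>" and A: "set_pmf (worlds \<alpha> \<beta> S) \<inter> A \<noteq> {}"
  shows "measure_pmf.expectation (cond_pmf (worlds \<alpha> \<beta> S) A) U =
    (\<Sum>\<omega>\<in>set_pmf (worlds \<alpha> \<beta> S) \<inter> A. pmf (worlds \<alpha> \<beta> S) \<omega> * U \<omega>) / measure (worlds \<alpha> \<beta> S) A"
proof -
  have "measure_pmf.expectation (cond_pmf (worlds \<alpha> \<beta> S) A) U =
      (\<Sum>\<omega>\<in>set_pmf (worlds \<alpha> \<beta> S) \<inter> A. U \<omega> * pmf (cond_pmf (worlds \<alpha> \<beta> S) A) \<omega>)"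
    using finite_worlds[OF S] A by (intro integral_measure_pmf_real) (auto simp: set_cond_pmf)
  also have "\<dots> = (\<Sum>\<omega>\<in>set_pmf (worlds \<alpha> \<beta> S) \<inter> A. pmf (worlds \<alpha> \<beta> S) \<omega> * U \<omega> / measure (worlds \<alpha> \<beta> S) A)"
    using A by (intro sum.cong refl) (auto simp: pmf_cond)
  finally show ?thesis
    by (simp add: sum_divide_distrib)
qed

text \<open>Reduces mixed deviations to pure ones. Since \<open>D\<close> may have infinite support,
  the iterated integral is taken over nonnegative functions, where Fubini holds without
  integrability.\<close>

lemma expectation_pair_pmf_le:
  fixes F :: "'a \<times> 'b \<Rightarrow> real"
  assumes "finite (set_pmf C)" "\<And>z. 0 \<le> F z" "0 \<le> c"
    and "\<And>x. x \<in> set_pmf D \<Longrightarrow> measure_pmf.expectation C (\<lambda>y. F (x, y)) \<le> c"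
  shows "measure_pmf.expectation (pair_pmf D C) F \<le> c"
proof (rule integral_real_bounded[OF assms(3)])
  have "(\<integral>\<^sup>+z. ennreal (F z) \<partial>pair_pmf D C) = (\<integral>\<^sup>+x. \<integral>\<^sup>+y. ennreal (F (x, y)) \<partial>C \<partial>D)"
    by (rule nn_integral_pair_pmf')
  also have "\<dots> \<le> (\<integral>\<^sup>+x. ennreal c \<partial>D)"
  proof (rule nn_integral_mono_AE, rule AE_pmfI)
    fix x
    assume "x \<in> set_pmf D"
    then show "(\<integral>\<^sup>+y. ennreal (F (x, y)) \<partial>C) \<le> ennreal c"
      using assms by (subst nn_integral_eq_integral) (auto intro!: integrable_measure_pmf_finite ennreal_leI)
  qed
  finally show "(\<integral>\<^sup>+z. ennreal (F z) \<partial>pair_pmf D C) \<le> ennreal c"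
    by simp
qed

lemma utility_nonneg: "0 \<le> utility p a os"
  by (simp add: utility_def)

lemma expected_utility_return:
  "expected_utility \<Lambda> W p s v (return_pmf \<sigma>) =
     measure_pmf.expectation (cond_pmf W {\<omega>. view \<Lambda> s \<omega> = v}) (\<lambda>\<omega>. utility p (focal \<omega>) (outputs \<Lambda> \<sigma> \<omega>))"
  by (simp add: expected_utility_def pair_return_pmf1)

lemma ring_protocol_equilibrium:
  assumes S: "knowledge_sharing k S" "2 \<le> \<alpha>" "\<alpha> \<le> \<beta>" "0 < k" and \<beta>: "\<beta> \<le> 2 * \<alpha> - 1"
  shows "distributed_equilibrium (ring_protocol \<beta> S) \<alpha> \<beta> S"
  unfolding distributed_equilibrium_def
proof (intro ballI allI impI)
  fix p s v D
  assume p: "p \<in> ks_range S" and v: "v \<in> view (ring_protocol \<beta> S) s ` set_pmf (worlds \<alpha> \<beta> S)"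
    and D: "set_pmf D \<subseteq> deviations (ring_protocol \<beta> S) s"
  define A where "A = {\<omega>. view (ring_protocol \<beta> S) s \<omega> = v}"
  define V where "V = set_pmf (worlds \<alpha> \<beta> S) \<inter> A"
  have \<alpha>: "1 \<le> \<alpha>"
    using S(2) by simp
  have A: "set_pmf (worlds \<alpha> \<beta> S) \<inter> A \<noteq> {}"
    using v by (auto simp: A_def)
  have valid: "valid_world \<alpha> \<beta> S \<omega>" "2 \<le> agents \<omega>" if "\<omega> \<in> V" for \<omega>
    using worlds_valid[OF S(1) \<alpha> S(3), of \<omega>] that S(2) by (auto simp: V_def valid_world_def)
  have main: "(\<Sum>\<omega>\<in>V. pmf (worlds \<alpha> \<beta> S) \<omega> * wins \<beta> S \<sigma> p \<omega>) \<le>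
      (\<Sum>\<omega>\<in>V. pmf (worlds \<alpha> \<beta> S) \<omega> * wins \<beta> S (ring_protocol \<beta> S) p \<omega>)" if \<sigma>: "\<sigma> \<in> set_pmf D" for \<sigma>
  \<comment> \<open>A view after Wake-Up contains the ring size, so the worlds in \<open>V\<close>
    are all late or all early. Late deviations are compared world by world, early ones orbit by
    orbit.\<close>
  proof (cases "\<exists>t. s = Round t \<and> (\<exists>\<omega>\<in>V. agents \<omega> \<le> t)")
    case True
    then obtain t \<omega>\<^sub>0 where t: "s = Round t" "\<omega>\<^sub>0 \<in> V" "agents \<omega>\<^sub>0 \<le> t"
      by blast
    have "agents \<omega> = agents \<omega>\<^sub>0" if "\<omega> \<in> V" for \<omega>
    proof -
      have "info 1 \<omega> (focal \<omega>) = info 1 \<omega>\<^sub>0 (focal \<omega>\<^sub>0)"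
        using that t(1,2) by (auto simp: V_def A_def view_def)
      then show ?thesis
        using ring_size_info[of 1 \<omega>] ring_size_info[of 1 \<omega>\<^sub>0] by (metis diff_add_inverse2)
    qed
    then have "agents \<omega> \<le> t" if "\<omega> \<in> V" for \<omega>
      using that t(3) by metis
    moreover have "\<sigma> \<in> deviations (ring_protocol \<beta> S) (Round t)"
      using \<sigma> D t(1) by auto
    ultimately show ?thesis
      using valid by (intro sum_mono mult_left_mono late_deviation[of \<alpha> \<beta> S _ t]) auto
  next
    case False
    have "change_input x \<omega> \<in> V" if "\<omega> \<in> V" "x \<in> ks_inputs S" for \<omega> x
      using that False view_change_input[OF valid[OF that(1)], of s _ x]
        change_input_worlds[OF S(1) \<alpha> S(3) _ that(2), of \<omega>]
      by (cases s) (auto simp: V_def A_def not_le)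
    moreover have "1 \<le> dup \<sigma>"
      using \<sigma> D by (auto simp: deviations_def split: stage.splits)
    ultimately show ?thesis
      using \<beta> by (intro sum_deviation_le[OF S(1-3) p S(4)]) (auto simp: V_def)
  qed
  have "finite (set_pmf (cond_pmf (worlds \<alpha> \<beta> S) A))"
    using finite_worlds[OF S(1) \<alpha> S(3)] A by (simp add: set_cond_pmf)
  then have "expected_utility (ring_protocol \<beta> S) (worlds \<alpha> \<beta> S) p s v D \<le>
      measure_pmf.expectation (cond_pmf (worlds \<alpha> \<beta> S) A) (wins \<beta> S (ring_protocol \<beta> S) p)"
    unfolding expected_utility_def A_def[symmetric]
    using main expectation_cond_worlds[OF S(1) \<alpha> S(3) A] 
    by (intro expectation_pair_pmf_le)
       (auto simp: utility_nonneg V_def intro!: divide_right_mono divide_nonneg_nonneg sum_nonneg)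
  then show "expected_utility (ring_protocol \<beta> S) (worlds \<alpha> \<beta> S) p s v D \<le>
      expected_utility (ring_protocol \<beta> S) (worlds \<alpha> \<beta> S) p s v (return_pmf (ring_protocol \<beta> S))"
    unfolding expected_utility_return A_def .
qed

lemma map_agents_worlds: "map_pmf agents (worlds \<alpha> \<beta> S) = geometric_prior \<alpha> \<beta>"
  by (simp add: worlds_def map_bind_pmf bind_return_pmf')

lemma ring_protocol_not_equilibrium:
  assumes S: "knowledge_sharing k S" "2 \<le> \<alpha>" "\<alpha> \<le> \<beta>" "2 \<le> k" and \<beta>: "2 * \<alpha> \<le> \<beta>"
  shows "\<not> distributed_equilibrium (ring_protocol \<beta> S) \<alpha> \<beta> S"
proof
  assume eq: "distributed_equilibrium (ring_protocol \<beta> S) \<alpha> \<beta> S"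
  define W where "W = worlds \<alpha> \<beta> S"
  define w where "w = view (ring_protocol \<beta> S) Wake_Up"
  have \<alpha>: "1 \<le> \<alpha>" "0 < k"
    using S(2,4) by simp_all
  have fin: "finite (set_pmf W)"
    unfolding W_def by (rule finite_worlds[OF S(1) \<alpha>(1) S(3)])
  have "ks_range S \<noteq> {}"
    using S(1,4) by (auto simp: knowledge_sharing_def)
  then obtain p where p: "p \<in> ks_range S"
    by blast
  obtain x\<^sub>0 where x\<^sub>0: "x\<^sub>0 \<in> ks_inputs S"
    using S(1) by (auto simp: knowledge_sharing_def)
  \<comment> \<open>The number of simulated agents is fixed before n is known; it is tuned to the
    most probable size \<alpha>, and for other sizes utility at least 0 is enough.\<close>
  define \<sigma> where "\<sigma> = cheat (\<alpha> + 1) S p x\<^sub>0"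
  \<comment> \<open>Summing over the views avoids computing their probabilities.\<close>
  have view_le: "(\<Sum>\<omega>\<in>{\<omega>\<in>set_pmf W. w \<omega> = v}. pmf W \<omega> * wins \<beta> S \<sigma> p \<omega>) \<le>
      (\<Sum>\<omega>\<in>{\<omega>\<in>set_pmf W. w \<omega> = v}. pmf W \<omega> * wins \<beta> S (ring_protocol \<beta> S) p \<omega>)"
    if v: "v \<in> w ` set_pmf W" for v
  proof -
    define A where "A = {\<omega>. w \<omega> = v}"
    have A: "set_pmf W \<inter> A \<noteq> {}"
      using v by (auto simp: A_def)
    then have "measure W A > 0"
      by (auto intro: measure_pmf_posI)
    moreover have "expected_utility (ring_protocol \<beta> S) W p Wake_Up v (return_pmf \<sigma>) \<le>
        expected_utility (ring_protocol \<beta> S) W p Wake_Up v (return_pmf (ring_protocol \<beta> S))"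
      using eq p v unfolding distributed_equilibrium_def W_def w_def
      by (auto simp: deviations_def \<sigma>_def cheat_def)
    ultimately show ?thesis
      using expectation_cond_worlds[OF S(1) \<alpha>(1) S(3), of A] A
      unfolding expected_utility_return W_def[symmetric] w_def[symmetric] A_def[symmetric]
      by (simp add: divide_le_cancel A_def Int_def)
  qed
  have "(\<Sum>\<omega>\<in>set_pmf W. pmf W \<omega> * wins \<beta> S \<sigma> p \<omega>) \<le>
      (\<Sum>\<omega>\<in>set_pmf W. pmf W \<omega> * wins \<beta> S (ring_protocol \<beta> S) p \<omega>)"
    unfolding sum.image_gen[OF fin, of _ w] by (intro sum_mono view_le)
  then have "k * (\<Sum>\<omega>\<in>set_pmf W. pmf W \<omega> * wins \<beta> S \<sigma> p \<omega>) \<le>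
      k * (\<Sum>\<omega>\<in>set_pmf W. pmf W \<omega> * wins \<beta> S (ring_protocol \<beta> S) p \<omega>)"
    by (intro mult_left_mono) auto
  also have "\<dots> = (\<Sum>\<omega>\<in>set_pmf W. pmf W \<omega>)"
    unfolding W_def using change_input_worlds[OF S(1) \<alpha>(1) S(3)]
    by (intro sum_honest[OF S(1-3) p \<alpha>(2)]) auto
  also have "\<dots> = 1"
    using fin by (intro sum_pmf_eq_1) auto
  finally have upper: "k * (\<Sum>\<omega>\<in>set_pmf W. pmf W \<omega> * wins \<beta> S \<sigma> p \<omega>) \<le> 1" .
  \<comment> \<open>The excess over one half is the constant c of the prior; its positivity decides
    the case k = 2.\<close>
  have "1 / 2 < pmf (geometric_prior \<alpha> \<beta>) \<alpha>"
    using S(3) by (simp add: pmf_geometric_prior power_int_minus)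
  also have "\<dots> = measure W {\<omega>. agents \<omega> = \<alpha>}"
    unfolding map_agents_worlds[of \<alpha> \<beta> S, symmetric] W_def pmf_map by (simp add: vimage_def)
  also have "\<dots> = measure W (set_pmf W \<inter> {\<omega>. agents \<omega> = \<alpha>})"
    by (subst Int_commute) (simp only: measure_Int_set_pmf)
  also have "\<dots> = (\<Sum>\<omega>\<in>set_pmf W \<inter> {\<omega>. agents \<omega> = \<alpha>}. pmf W \<omega>)"
    using fin by (intro measure_measure_pmf_finite) auto
  also have "\<dots> = (\<Sum>\<omega>\<in>set_pmf W \<inter> {\<omega>. agents \<omega> = \<alpha>}. pmf W \<omega> * wins \<beta> S \<sigma> p \<omega>)"
  proof (intro sum.cong refl)
    fix \<omega>
    assume "\<omega> \<in> set_pmf W \<inter> {\<omega>. agents \<omega> = \<alpha>}"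
    then show "pmf W \<omega> = pmf W \<omega> * wins \<beta> S \<sigma> p \<omega>"
      using cheat_wins[OF S(1) p \<alpha>(2) x\<^sub>0 worlds_valid[OF S(1) \<alpha>(1) S(3)], of \<omega> "\<alpha> + 1"] S(2) \<beta>
      by (simp add: \<sigma>_def W_def)
  qed
  also have "\<dots> \<le> (\<Sum>\<omega>\<in>set_pmf W. pmf W \<omega> * wins \<beta> S \<sigma> p \<omega>)"
    using fin by (intro sum_mono2) (auto simp: utility_nonneg)
  finally have "1 / 2 < (\<Sum>\<omega>\<in>set_pmf W. pmf W \<omega> * wins \<beta> S \<sigma> p \<omega>)" .
  then have "2 * (1 / 2) < k * (\<Sum>\<omega>\<in>set_pmf W. pmf W \<omega> * wins \<beta> S \<sigma> p \<omega>)"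
    using S(4) by (intro mult_le_less_imp_less) auto
  then show False
    using upper by simp
qed

text \<open>An instance of Knowledge Sharing has to exist before the equilibrium claim for all
  instances can bound \<beta>; without one that claim would hold vacuously. Changing one bit flips
  the parity, whence Full Knowledge.\<close>

definition parity :: ks where
  "parity = \<lparr>ks_inputs = {0, 1}, ks_bits = 1, ks_fun = \<lambda>xs. sum_list xs mod 2\<rparr>"

lemma knowledge_sharing_parity: "knowledge_sharing 2 parity"
proof -
  have range: "ks_range parity = {0, 1}"
  proof
    show "ks_range parity \<subseteq> {0, 1}"
      by (auto simp: ks_range_def parity_def)
    have "ks_fun parity [0] \<in> ks_range parity" "ks_fun parity [1] \<in> ks_range parity"
      unfolding ks_range_def by (intro imageI; simp add: parity_def)+
    then show "{0, 1} \<subseteq> ks_range parity"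
      by (simp add: parity_def)
  qed
  have "card {x \<in> {0, 1}. sum_list (xs[j := x]) mod 2 = y} = 1" if "j < length xs" "y \<in> {0, 1}" for xs j and y :: nat
  proof -
    \<comment> \<open>The subtraction of naturals is exact, as \<open>xs ! j\<close> is one of the
      summands.\<close>
    define c where "c = sum_list xs - xs ! j"
    have "sum_list (xs[j := x]) = x + c" for x
      using that(1) elem_le_sum_list[of j xs] by (simp add: sum_list_update c_def)
    then have "{x \<in> {0, 1}. sum_list (xs[j := x]) mod 2 = y} = {(y + c) mod 2}"
      using that(2) by auto presburger+
    then show ?thesis
      by simp
  qed
  then have "full_knowledge parity"
    unfolding full_knowledge_def range by (simp add: parity_def)
  then show ?thesis
    by (simp add: knowledge_sharing_def range) (simp add: parity_def)
qed

theorem mainTheorem6: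
  fixes \<alpha> \<beta> :: nat
  assumes "2 \<le> \<alpha>" and "\<alpha> \<le> \<beta>"
  shows "(\<forall>k\<ge>2. \<forall>S. knowledge_sharing k S \<longrightarrow>
            (distributed_equilibrium (ring_protocol \<beta> S) \<alpha> \<beta> S \<longleftrightarrow> \<beta> \<le> 2 * \<alpha> - 1))
       \<and> ((\<forall>k\<ge>2. \<forall>S. knowledge_sharing k S \<longrightarrow>
            distributed_equilibrium (ring_protocol \<beta> S) \<alpha> \<beta> S) \<longleftrightarrow> \<beta> \<le> 2 * \<alpha> - 1)"
proof -
  have "distributed_equilibrium (ring_protocol \<beta> S) \<alpha> \<beta> S \<longleftrightarrow> \<beta> \<le> 2 * \<alpha> - 1"
    if "2 \<le> k" "knowledge_sharing k S" for k S
    using ring_protocol_equilibrium[OF that(2) assms] ring_protocol_not_equilibrium[OF that(2) assms that(1)] that(1) by fastforce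
  then show ?thesis
    using knowledge_sharing_parity by blast
qed

end
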